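(* Let $\boldsymbol{\alpha}$ and $\boldsymbol{\beta}$ be integer compositions (finite sequences of positive integers) and suppose that $X_{P_{\boldsymbol{\alpha}}}=X_{P_{\boldsymbol{\beta}}}$. If one of the following conditions holds, then the signed paths $P_{\boldsymbol{\alpha}}$ and $P_{\boldsymbol{\beta}}$ are isomorphic: (1) the length of $\boldsymbol{\alpha}$ is less than or equal to $4$; (2) $\boldsymbol{\alpha}$ and $\boldsymbol{\beta}$ are both unimodal.
   Context: A signed graph is a quadruple $\Gamma=(V_\Gamma,E_\Gamma^+,E_\Gamma^-,L_\Gamma)$ where $V_\Gamma$ is a finite set (vertices), $E_\Gamma^+$ and $E_\Gamma^-$ are sets of 2-element subsets of $V_\Gamma$ (positive and negative edges), and $L_\Gamma\subseteq V_\Gamma$ (loops). Two signed graphs are isomorphic if there is a bijection of vertex sets carrying positive edges onto positive edges, negative edges onto negative edges, and loops onto loops. A map $\kappa:V_\Gamma\to\mathbb{Z}$ is a proper coloring if $\kappa(v)\ne\kappa(w)$ for $\{v,w\}\in E_\Gamma^+$, $\kappa(v)\neq-\kappa(w)$ for $\{v,w\}\in E_\Gamma^-$, and $\kappa(v)\ne0$ for $v\in L_\Gamma$. With indeterminates $(x_i)_{i\in\mathbb{Z}}$, the chromatic signed-symmetric function of $\Gamma$ is the formal power series $X_\Gamma=\sum_{\kappa}\prod_{v\in V_\Gamma}x_{\kappa(v)}$, the sum being over all proper colorings $\kappa:V_\Gamma\to\mathbb{Z}$. For a composition $\boldsymbol\alpha=(\alpha_1,\dots,\alpha_\ell)\in\mathbb{Z}_{>0}^\ell$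 of length $\ell\geq 1$, $P_{\boldsymbol\alpha}$ is the signed path (with no loops) obtained by taking paths $P_{\alpha_1},\dots,P_{\alpha_\ell}$ on $\alpha_1,\dots,\alpha_\ell$ vertices, all of whose edges are positive, and connecting them in this order into one path by negative edges (the last vertex of $P_{\alpha_i}$ is joined to the first vertex of $P_{\alpha_{i+1}}$ by a negative edge, for $1\le i<\ell$). The composition $\boldsymbol\alpha$ is unimodal if there is $t\in\{1,\dots,\ell\}$ with $\alpha_1\le\dots\le\alpha_t\ge\dots\ge\alpha_\ell$. *)

theory Defs
  imports Main "HOL-Library.FuncSet" "HOL-Library.Poly_Mapping"
begin

section \<open>Signed graphs\<close>

record 'a signed_graph =
  verts :: "'a set"
  pos_edges :: "'a set set"
  neg_edges :: "'a set set"
  loops :: "'a set"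

definition wf_signed_graph :: "'a signed_graph \<Rightarrow> bool" where
  "wf_signed_graph G \<longleftrightarrow>
     finite (verts G) \<and>
     (\<forall>e\<in>pos_edges G. e \<subseteq> verts G \<and> card e = 2) \<and>
     (\<forall>e\<in>neg_edges G. e \<subseteq> verts G \<and> card e = 2) \<and>
     loops G \<subseteq> verts G"

definition isomorphic :: "'a signed_graph \<Rightarrow> 'b signed_graph \<Rightarrow> bool" where
  "isomorphic G H \<longleftrightarrow>
     (\<exists>f. bij_betw f (verts G) (verts H) \<and>
          (\<lambda>e. f ` e) ` pos_edges G = pos_edges H \<and>
          (\<lambda>e. f ` e) ` neg_edges G = neg_edges H \<and>
          f ` loops G = loops H)"

section \<open>The chromatic signed-symmetric function\<close>

text \<open>
  Colorings are extensional functions (\<^const>\<open>undefined\<close> off the vertex set), so that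
  maps from the vertex set to the integers are counted without repetition.
\<close>

definition proper_colorings :: "'a signed_graph \<Rightarrow> ('a \<Rightarrow> int) set" where
  "proper_colorings G =
     {\<kappa> \<in> verts G \<rightarrow>\<^sub>E UNIV.
        (\<forall>v w. {v, w} \<in> pos_edges G \<longrightarrow> \<kappa> v \<noteq> \<kappa> w) \<and>
        (\<forall>v w. {v, w} \<in> neg_edges G \<longrightarrow> \<kappa> v \<noteq> - \<kappa> w) \<and>
        (\<forall>v\<in>loops G. \<kappa> v \<noteq> 0)}"

text \<open>
  Monomials in the indeterminates \<open>x\<^sub>i\<close>, \<open>i\<close> an integer, are represented by their exponent
  vectors, and a formal power series by its coefficient function on monomials.
\<close>

type_synonym monomial = "int \<Rightarrow>\<^sub>0 nat"
type_synonym power_series = "monomial \<Rightarrow> int"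

text \<open>The exponent vector of the product of the \<open>x\<^bsub>\<kappa> v\<^esub>\<close> over all vertices \<open>v\<close>:\<close>

definition coloring_monomial :: "'a signed_graph \<Rightarrow> ('a \<Rightarrow> int) \<Rightarrow> monomial" where
  "coloring_monomial G \<kappa> = (\<Sum>v\<in>verts G. Poly_Mapping.single (\<kappa> v) 1)"

text \<open>
  The sum over all proper colorings of their monomials: its coefficient at \<open>m\<close> is the number
  of proper colorings with monomial \<open>m\<close>. Lemma \<open>finite_colorings_of_monomial\<close> below shows that
  this number is finite, so the cardinality is never the default value for infinite sets.
\<close>

definition chromatic :: "'a signed_graph \<Rightarrow> power_series" where
  "chromatic G = (\<lambda>m. int (card {\<kappa> \<in> proper_colorings G. coloring_monomial G \<kappa> = m}))"

text \<open>
  In the polynomial ring over the integers, where \<open>x\<^sub>i\<close> is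
  \<open>Poly_Mapping.single (Poly_Mapping.single i 1) 1\<close>, the product of the \<open>x\<^bsub>\<kappa> v\<^esub>\<close> is
  indeed the monomial with exponent vector \<open>coloring_monomial G \<kappa>\<close>.
\<close>

lemma prod_indeterminates:
  "(\<Prod>v\<in>verts G. Poly_Mapping.single (Poly_Mapping.single (\<kappa> v) 1) 1 :: monomial \<Rightarrow>\<^sub>0 int)
     = Poly_Mapping.single (coloring_monomial G \<kappa>) 1"
proof -
  have "(\<Prod>v\<in>A. Poly_Mapping.single (Poly_Mapping.single (\<kappa> v) 1) 1 :: monomial \<Rightarrow>\<^sub>0 int)
          = Poly_Mapping.single (\<Sum>v\<in>A. Poly_Mapping.single (\<kappa> v) 1) 1" for A
    by (induction A rule: infinite_finite_induct) (simp_all add: mult_single)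
  thus ?thesis
    by (simp only: coloring_monomial_def)
qed

lemma finite_colorings_of_monomial:
  assumes "finite (verts G)"
  shows "finite {\<kappa> \<in> proper_colorings G. coloring_monomial G \<kappa> = m}"
proof (rule finite_subset)
  show "finite (verts G \<rightarrow>\<^sub>E Poly_Mapping.keys m)"
    using assms by (simp add: finite_PiE)
  show "{\<kappa> \<in> proper_colorings G. coloring_monomial G \<kappa> = m} \<subseteq> verts G \<rightarrow>\<^sub>E Poly_Mapping.keys m"
  proof
    fix \<kappa> assume *: "\<kappa> \<in> {\<kappa> \<in> proper_colorings G. coloring_monomial G \<kappa> = m}"
    have "\<kappa> v \<in> Poly_Mapping.keys m" if "v \<in> verts G" for v
    proof -
      have "Poly_Mapping.lookup m (\<kappa> v)
              = (\<Sum>u\<in>verts G. Poly_Mapping.lookup (Poly_Mapping.single (\<kappa> u) 1) (\<kappa> v))"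
        using * by (auto simp: coloring_monomial_def lookup_sum)
      also have "\<dots> \<ge> Poly_Mapping.lookup (Poly_Mapping.single (\<kappa> v) 1) (\<kappa> v)"
        using assms that by (intro member_le_sum) auto
      finally show ?thesis
        by (simp add: in_keys_iff)
    qed
    with * show "\<kappa> \<in> verts G \<rightarrow>\<^sub>E Poly_Mapping.keys m"
      by (auto simp: proper_colorings_def PiE_iff)
  qed
qed

section \<open>Compositions and signed paths\<close>

definition composition :: "nat list \<Rightarrow> bool" where
  "composition \<alpha> \<longleftrightarrow> \<alpha> \<noteq> [] \<and> (\<forall>a\<in>set \<alpha>. 0 < a)"

definition unimodal :: "nat list \<Rightarrow> bool" where
  "unimodal \<alpha> \<longleftrightarrow>
     (\<exists>t<length \<alpha>. (\<forall>i. i < t \<longrightarrow> \<alpha> ! i \<le> \<alpha> ! Suc i) \<and>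
                   (\<forall>i. t \<le> i \<and> Suc i < length \<alpha> \<longrightarrow> \<alpha> ! i \<ge> \<alpha> ! Suc i))"

text \<open>The vertex \<open>(i, j)\<close> is the \<open>j\<close>-th vertex of the \<open>i\<close>-th positive path, counting from 0.\<close>

definition signed_path :: "nat list \<Rightarrow> (nat \<times> nat) signed_graph" where
  "signed_path \<alpha> =
     \<lparr>verts = {(i, j). i < length \<alpha> \<and> j < \<alpha> ! i},
      pos_edges = {{(i, j), (i, Suc j)} | i j. i < length \<alpha> \<and> Suc j < \<alpha> ! i},
      neg_edges = {{(i, \<alpha> ! i - 1), (Suc i, 0)} | i. Suc i < length \<alpha>},
      loops = {}\<rparr>"

lemma wf_signed_path:
  assumes "composition \<alpha>"
  shows "wf_signed_graph (signed_path \<alpha>)"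
proof -
  have *: "0 < \<alpha> ! i" if "i < length \<alpha>" for i
    using assms that by (auto simp: composition_def)
  have "{(i, j). i < length \<alpha> \<and> j < \<alpha> ! i} = Sigma {..<length \<alpha>} (\<lambda>i. {..<\<alpha> ! i})"
    by auto
  hence "finite {(i, j). i < length \<alpha> \<and> j < \<alpha> ! i}"
    by simp
  thus ?thesis
    using * by (auto simp: wf_signed_graph_def signed_path_def)
qed

end

theory Submission
  imports
    Defs
    Complex_Main
    "HOL-Computational_Algebra.Formal_Power_Series"
    "HOL-Computational_Algebra.Fundamental_Theorem_Algebra"
begin

text \<open>
  Multiplying the color of each vertex by the sign of its run turns the proper colorings of
  \<open>P\<^sub>\<alpha>\<close> into words without equal adjacent letters. Inclusion-exclusion over such words expresses
  \<open>X\<close> of the path as a signed sum over the ways of cutting it into segments, where a segment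
  contributes the power sum \<open>\<Sum>\<^sub>i x\<^sub>i\<^sup>a x\<^bsub>-i\<^esub>\<^sup>b\<close>, with \<open>a\<close> and \<open>b\<close> the numbers of its vertices of either
  sign. For suitable complex values of the variables, the segments contained in a run get
  arbitrary weights \<open>g + t\<close> depending on their length, and all other segments get the weight \<open>t\<close>.

  The part of degree 0 in \<open>t\<close> is a product of weights \<open>G (\<alpha>\<^sub>i)\<close> with \<open>G\<close> arbitrary, so the multiset
  of parts is determined. The part of degree 1 is the sum, over all ways to remove a segment, of
  the products of the weights \<open>G\<close> of the remaining runs and pieces of runs on either side.
  Sorting these products by their number of factors and comparing the terms with \<open>k + 1\<close>
  factors, where \<open>k\<close> is the length of the longest common prefix, shows that the common suffix
  has length \<open>k\<close> too. Under either condition of the theorem, the two entries that follow the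
  prefix and precede the suffix are then swapped between \<open>\<alpha>\<close> and \<open>\<beta>\<close>, and the suffix is the
  reversed prefix; hence \<open>\<alpha>\<close> and the reversal of \<open>\<beta>\<close> have a longer common prefix.
\<close>

section \<open>Prescribing power sums\<close>

text \<open>The \<open>m\<close>-th power of a primitive \<open>n\<close>-th root of unity is an
  \<open>n\<close>-th root of unity other than 1, so the geometric sum vanishes.\<close>

lemma sum_powers_root_of_unity:
  assumes "0 < m" "m < n"
  shows "(\<Sum>k<n. (cis (2 * pi / real n) ^ k) ^ m) = 0"
proof -
  let ?z = "cis (2 * pi / real n) ^ m"
  have "?z \<noteq> 1"
  proof
    assume "?z = 1"
    then have eq: "cis (2 * pi * real m / real n) = cis (2 * pi * real 0 / real n)"
      by (simp add: DeMoivre algebra_simps)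
    have "inj_on (\<lambda>k. cis (2 * pi * real k / real n)) {..<n}"
      using assms by (intro bij_betw_imp_inj_on[OF bij_betw_roots_unity]) simp
    from inj_onD[OF this eq] have "m = 0"
      using assms by simp
    then show False
      using assms by simp
  qed
  moreover have "?z ^ n = 1"
  proof -
    have "?z ^ n = (cis (2 * pi / real n) ^ n) ^ m"
      by (simp add: power_mult[symmetric] mult.commute)
    also have "cis (2 * pi / real n) ^ n = 1"
      using assms by (simp add: DeMoivre)
    finally show ?thesis
      by simp
  qed
  ultimately have "(\<Sum>k<n. ?z ^ k) = 0"
    by (simp add: sum_gp_strict)
  then show ?thesis
    by (simp add: power_mult[symmetric] mult.commute)
qed

text \<open>Works exponent by exponent: numbers are appended that leave the lower power sums
  unchanged, and a complex root \<open>v\<close> is chosen to correct the next one.\<close>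

lemma ex_power_sums:
  fixes c :: "nat \<Rightarrow> complex"
  shows "\<exists>ys. \<forall>m. 0 < m \<and> m \<le> n \<longrightarrow> (\<Sum>y\<leftarrow>ys. y ^ m) = c m"
proof (induction n)
  case 0
  show ?case by auto
next
  case (Suc n)
  then obtain ys where ys: "\<And>m. 0 < m \<Longrightarrow> m \<le> n \<Longrightarrow> (\<Sum>y\<leftarrow>ys. y ^ m) = c m"
    by blast
  obtain v where v: "v ^ Suc n = (c (Suc n) - (\<Sum>y\<leftarrow>ys. y ^ Suc n)) / of_nat (Suc n)"
    using nth_root_exists[of "Suc n"] by blast
  \<comment> \<open>adding all \<open>v * \<omega> ^ k\<close> changes no power sum of exponent at most \<open>n\<close>\<close>
  define \<omega> where "\<omega> = cis (2 * pi / real (Suc n))"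
  define zs where "zs = map (\<lambda>k. v * \<omega> ^ k) [0..<Suc n]"
  have zs: "(\<Sum>z\<leftarrow>zs. z ^ m) = v ^ m * (\<Sum>k<Suc n. (\<omega> ^ k) ^ m)" for m
    unfolding zs_def map_map comp_def interv_sum_list_conv_sum_set_nat sum_distrib_left
    by (simp add: power_mult_distrib atLeast0LessThan)
  have "(\<Sum>y\<leftarrow>ys @ zs. y ^ m) = c m" if "0 < m" "m \<le> Suc n" for m
  proof (cases "m = Suc n")
    case True
    have "\<omega> ^ Suc n = 1"
      unfolding \<omega>_def DeMoivre by simp
    then have "(\<omega> ^ k) ^ Suc n = 1" for k
      by (metis mult.commute power_mult power_one)
    then have "(\<Sum>z\<leftarrow>zs. z ^ Suc n) = v ^ Suc n * of_nat (Suc n)"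
      by (simp add: zs del: power_Suc sum.lessThan_Suc)
    then show ?thesis
      using True v by (simp del: power_Suc of_nat_Suc)
  next
    case False
    then have "(\<Sum>z\<leftarrow>zs. z ^ m) = 0"
      using that sum_powers_root_of_unity[of m "Suc n"] by (simp add: zs \<omega>_def)
    then show ?thesis
      using ys that False by simp
  qed
  then have "\<forall>m. 0 < m \<and> m \<le> Suc n \<longrightarrow> (\<Sum>y\<leftarrow>ys @ zs. y ^ m) = c m"
    by (intro allI impI) (elim conjE)
  then show ?case
    by (rule exI)
qed

text \<open>If \<open>G\<close> has generating function \<open>F\<close>, the weights
  \<open>g\<close> have generating function \<open>1 - 1 / F\<close>. Summing products of
  \<open>g\<close> over all ways of cutting a run of length \<open>m\<close> into segments then
  gives \<open>G m\<close>, so the total weight of a run can be prescribed freely.\<close>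

lemma ex_prefix_weights:
  fixes G :: "nat \<Rightarrow> 'a :: field"
  assumes "G 0 = 1"
  obtains g where "\<And>m. 0 < m \<Longrightarrow> (\<Sum>k<m. g (Suc k) * G (m - Suc k)) = G m"
proof
  let ?F = "Abs_fps G"
  let ?g = "1 - inverse ?F"
  fix m :: nat assume "0 < m"
  have "?g * ?F = ?F - 1"
    using assms by (simp add: left_diff_distrib inverse_mult_eq_1)
  then have "fps_nth (?g * ?F) m = G m"
    using \<open>0 < m\<close> by simp
  moreover have "fps_nth ?g 0 = 0"
    using assms by simp
  moreover have "{0..m} = insert 0 (Suc ` {..<m})"
    by (auto simp: image_Suc_lessThan)
  then have "(\<Sum>k\<in>{0..m}. f k) = f 0 + (\<Sum>k<m. f (Suc k))" for f :: "nat \<Rightarrow> 'a"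
    by (simp add: sum.reindex)
  ultimately show "(\<Sum>k<m. fps_nth ?g (Suc k) * G (m - Suc k)) = G m"
    unfolding fps_mult_nth by (simp del: fps_sub_nth)
qed

section \<open>From signed paths to words\<close>

lemma finite_colorings_into:
  assumes "finite (verts G)" "finite C"
  shows "finite {\<kappa> \<in> proper_colorings G. \<kappa> ` verts G \<subseteq> C}"
proof (rule finite_subset)
  show "finite (verts G \<rightarrow>\<^sub>E C)"
    using assms by (simp add: finite_PiE)
  show "{\<kappa> \<in> proper_colorings G. \<kappa> ` verts G \<subseteq> C} \<subseteq> verts G \<rightarrow>\<^sub>E C"
    by (auto simp: proper_colorings_def PiE_iff extensional_def)
qed

lemma keys_coloring_monomial: "Poly_Mapping.keys (coloring_monomial G \<kappa>) \<subseteq> \<kappa> ` verts G"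
  using keys_sum[of "\<lambda>v. Poly_Mapping.single (\<kappa> v) (1::nat)" "verts G"]
  by (force simp: coloring_monomial_def)

text \<open>Evaluates the power series with all variables outside \<open>C\<close> set to 0. The set
  \<open>M\<close> may contain further monomials over \<open>C\<close>, so that one \<open>M\<close>
  serves two graphs.\<close>

lemma sum_colorings_eq_sum_chromatic:
  fixes x :: "int \<Rightarrow> 'a :: comm_ring_1"
  assumes fin: "finite (verts G)" "finite C" "finite M"
    and M: "\<And>\<kappa>. \<kappa> \<in> proper_colorings G \<Longrightarrow> \<kappa> ` verts G \<subseteq> C \<Longrightarrow> coloring_monomial G \<kappa> \<in> M"
    and keys: "\<And>m. m \<in> M \<Longrightarrow> Poly_Mapping.keys m \<subseteq> C"
  shows "(\<Sum>\<kappa> | \<kappa> \<in> proper_colorings G \<and> \<kappa> ` verts G \<subseteq> C. \<Prod>v\<in>verts G. x (\<kappa> v))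
       = (\<Sum>m\<in>M. of_int (chromatic G m) * (\<Prod>i\<in>C. x i ^ Poly_Mapping.lookup m i))"
proof -
  let ?ev = "\<lambda>m. \<Prod>i\<in>C. x i ^ Poly_Mapping.lookup m i"
  let ?K = "{\<kappa> \<in> proper_colorings G. \<kappa> ` verts G \<subseteq> C}"
  have finK: "finite ?K"
    using fin by (intro finite_colorings_into)
  have single: "?ev (Poly_Mapping.single i 1) = x i" if "i \<in> C" for i
  proof -
    have "?ev (Poly_Mapping.single i 1) = (\<Prod>j\<in>C. if j = i then x i else 1)"
      by (intro prod.cong) (auto simp: lookup_single when_def)
    then show ?thesis
      using that fin by simp
  qed
  have ev: "?ev (\<Sum>v\<in>A. Poly_Mapping.single (\<kappa> v) 1) = (\<Prod>v\<in>A. x (\<kappa> v))"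
    if "finite A" "\<kappa> ` A \<subseteq> C" for A :: "'b set" and \<kappa>
    using that by (induction A rule: finite_induct)
      (simp_all add: lookup_add power_add prod.distrib single del: One_nat_def)
  \<comment> \<open>A coloring whose monomial lies in \<open>M\<close> uses colors of
    \<open>C\<close> only, so \<open>chromatic G m\<close> counts no colorings outside
    \<open>?K\<close>.\<close>
  have in_C: "\<kappa> ` verts G \<subseteq> C" if "coloring_monomial G \<kappa> = m" "m \<in> M" for \<kappa> m
  proof
    fix i assume "i \<in> \<kappa> ` verts G"
    then obtain v where v: "v \<in> verts G" "i = \<kappa> v"
      by blast
    have "Poly_Mapping.lookup (Poly_Mapping.single (\<kappa> v) 1) i
        \<le> (\<Sum>u\<in>verts G. Poly_Mapping.lookup (Poly_Mapping.single (\<kappa> u) (1::nat)) i)"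
      using fin v by (intro member_le_sum) auto
    then have "i \<in> Poly_Mapping.keys m"
      using v that by (auto simp: coloring_monomial_def lookup_sum in_keys_iff)
    then show "i \<in> C"
      using keys that by blast
  qed
  have "(\<Sum>\<kappa>\<in>?K. \<Prod>v\<in>verts G. x (\<kappa> v)) = (\<Sum>\<kappa>\<in>?K. ?ev (coloring_monomial G \<kappa>))"
    unfolding coloring_monomial_def by (intro sum.cong refl ev[symmetric]) (use fin in auto)
  also have "\<dots> = (\<Sum>m\<in>M. \<Sum>\<kappa> | \<kappa> \<in> ?K \<and> coloring_monomial G \<kappa> = m. ?ev (coloring_monomial G \<kappa>))"
    using finK fin M by (intro sum.group[symmetric]) auto
  also have "\<dots> = (\<Sum>m\<in>M. of_int (chromatic G m) * ?ev m)"
  proof (intro sum.cong refl)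
    fix m assume "m \<in> M"
    then have "{\<kappa>. \<kappa> \<in> ?K \<and> coloring_monomial G \<kappa> = m}
        = {\<kappa> \<in> proper_colorings G. coloring_monomial G \<kappa> = m}"
      using in_C by auto
    then show "(\<Sum>\<kappa> | \<kappa> \<in> ?K \<and> coloring_monomial G \<kappa> = m. ?ev (coloring_monomial G \<kappa>))
        = of_int (chromatic G m) * ?ev m"
      by (simp add: chromatic_def)
  qed
  finally show ?thesis
    by simp
qed

lemma sum_colorings_cong_chromatic:
  fixes x :: "int \<Rightarrow> 'a :: comm_ring_1"
  assumes "finite (verts G)" "finite (verts H)" "chromatic G = chromatic H" "finite C"
  shows "(\<Sum>\<kappa> | \<kappa> \<in> proper_colorings G \<and> \<kappa> ` verts G \<subseteq> C. \<Prod>v\<in>verts G. x (\<kappa> v))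
       = (\<Sum>\<kappa> | \<kappa> \<in> proper_colorings H \<and> \<kappa> ` verts H \<subseteq> C. \<Prod>v\<in>verts H. x (\<kappa> v))"
proof -
  define M where "M = coloring_monomial G ` {\<kappa> \<in> proper_colorings G. \<kappa> ` verts G \<subseteq> C}
    \<union> coloring_monomial H ` {\<kappa> \<in> proper_colorings H. \<kappa> ` verts H \<subseteq> C}"
  have fin: "finite M"
    unfolding M_def using assms by (intro finite_UnI finite_imageI finite_colorings_into)
  have keys: "Poly_Mapping.keys m \<subseteq> C" if "m \<in> M" for m
    using that keys_coloring_monomial[of G] keys_coloring_monomial[of H] unfolding M_def by blast
  have "(\<Sum>\<kappa> | \<kappa> \<in> proper_colorings G \<and> \<kappa> ` verts G \<subseteq> C. \<Prod>v\<in>verts G. x (\<kappa> v))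
      = (\<Sum>m\<in>M. of_int (chromatic G m) * (\<Prod>i\<in>C. x i ^ Poly_Mapping.lookup m i))"
    by (rule sum_colorings_eq_sum_chromatic) (use assms fin keys in \<open>auto simp: M_def\<close>)
  moreover have "(\<Sum>\<kappa> | \<kappa> \<in> proper_colorings H \<and> \<kappa> ` verts H \<subseteq> C. \<Prod>v\<in>verts H. x (\<kappa> v))
      = (\<Sum>m\<in>M. of_int (chromatic H m) * (\<Prod>i\<in>C. x i ^ Poly_Mapping.lookup m i))"
    by (rule sum_colorings_eq_sum_chromatic) (use assms fin keys in \<open>auto simp: M_def\<close>)
  ultimately show ?thesis
    using assms by simp
qed

section \<open>Inclusion-exclusion over words of signs\<close>

definition sgn_of :: "bool \<Rightarrow> int" where
  "sgn_of b = (if b then 1 else - 1)"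

lemma sgn_of_mult_self [simp]: "sgn_of b * (sgn_of b * i) = i"
  by (simp add: sgn_of_def)

text \<open>A list of signs stands for a signed path: an edge is positive iff its ends have the same sign.\<close>

definition sign_proper :: "bool list \<Rightarrow> int list \<Rightarrow> bool" where
  "sign_proper es cs \<longleftrightarrow>
     successively (\<lambda>(e, c) (e', c'). sgn_of e * c \<noteq> sgn_of e' * c') (zip es cs)"

definition word_colorings :: "int set \<Rightarrow> bool list \<Rightarrow> int list set" where
  "word_colorings C es = {cs. length cs = length es \<and> set cs \<subseteq> C \<and> sign_proper es cs}"

definition word_sum :: "(int \<Rightarrow> 'a::comm_ring_1) \<Rightarrow> int set \<Rightarrow> bool list \<Rightarrow> 'a" where
  "word_sum x C es = (\<Sum>cs\<in>word_colorings C es. \<Prod>c\<leftarrow>cs. x c)"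

text \<open>Here \<open>i\<close> is the first letter after switching signs, that is, of the word in
  which equal adjacent letters are forbidden.\<close>

definition starts_with :: "bool list \<Rightarrow> int \<Rightarrow> int list \<Rightarrow> bool" where
  "starts_with es i cs \<longleftrightarrow> cs \<noteq> [] \<and> sgn_of (hd es) * hd cs = i"

definition word_sum_start :: "(int \<Rightarrow> 'a::comm_ring_1) \<Rightarrow> int set \<Rightarrow> int \<Rightarrow> bool list \<Rightarrow> 'a" where
  "word_sum_start x C i es = (\<Sum>cs | cs \<in> word_colorings C es \<and> starts_with es i cs. \<Prod>c\<leftarrow>cs. x c)"

lemma finite_word_colorings: "finite C \<Longrightarrow> finite (word_colorings C es)"
  by (rule finite_subset[OF _ finite_lists_length_eq[of C "length es"]])
    (auto simp: word_colorings_def)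

lemma word_colorings_Cons:
  "c # cs \<in> word_colorings C (e # es) \<longleftrightarrow>
     c \<in> C \<and> cs \<in> word_colorings C es \<and> \<not> starts_with es (sgn_of e * c) cs"
  by (cases es; cases cs) (auto simp: word_colorings_def sign_proper_def starts_with_def)

text \<open>The first color must be \<open>sgn_of e * i\<close>, and the rest may be any proper word
  that does not itself start with \<open>i\<close>; such words are counted by complement.\<close>

lemma word_sum_start_Cons:
  assumes "finite C" "uminus ` C = C" "i \<in> C"
  shows "word_sum_start x C i (e # es)
       = x (sgn_of e * i) * (word_sum x C es - word_sum_start x C i es)"
proof -
  have [simp]: "sgn_of e * i \<in> C"
    using assms(2,3) by (auto simp: sgn_of_def)
  have "{cs. cs \<in> word_colorings C (e # es) \<and> starts_with (e # es) i cs}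
      = Cons (sgn_of e * i) `
          (word_colorings C es - {cs. cs \<in> word_colorings C es \<and> starts_with es i cs})"
    (is "?L = ?R")
  proof (intro set_eqI)
    fix cs show "cs \<in> ?L \<longleftrightarrow> cs \<in> ?R"
    proof (cases cs)
      case Nil
      then show ?thesis by (auto simp: starts_with_def)
    next
      case (Cons c cs')
      have "sgn_of e * c = i \<longleftrightarrow> c = sgn_of e * i"
        by (metis sgn_of_mult_self)
      then show ?thesis
        unfolding Cons
        by (cases "c = sgn_of e * i") (auto simp: word_colorings_Cons starts_with_def[of "e # es"])
    qed
  qed
  then have "word_sum_start x C i (e # es) =
      (\<Sum>cs\<in>word_colorings C es - {cs. cs \<in> word_colorings C es \<and> starts_with es i cs}.
        x (sgn_of e * i) * (\<Prod>c\<leftarrow>cs. x c))"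
    unfolding word_sum_start_def by (simp add: sum.reindex)
  then show ?thesis
    unfolding word_sum_start_def word_sum_def
    by (subst (asm) sum_distrib_left[symmetric], subst (asm) sum_diff)
      (auto simp: finite_word_colorings assms)
qed

lemma word_sum_Cons:
  assumes "finite C" "uminus ` C = C"
  shows "word_sum x C (e # es) = (\<Sum>i\<in>C. word_sum_start x C i (e # es))"
proof -
  let ?h = "\<lambda>cs. sgn_of e * hd cs"
  have "?h ` word_colorings C (e # es) \<subseteq> C"
  proof (clarify)
    fix cs assume "cs \<in> word_colorings C (e # es)"
    then obtain c cs' where "cs = c # cs'" "c \<in> C"
      by (cases cs) (auto simp: word_colorings_def)
    then show "sgn_of e * hd cs \<in> C"
      using assms(2) by (auto simp: sgn_of_def)
  qed
  then have "word_sum x C (e # es)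
      = (\<Sum>i\<in>C. \<Sum>cs | cs \<in> word_colorings C (e # es) \<and> ?h cs = i. \<Prod>c\<leftarrow>cs. x c)"
    unfolding word_sum_def
    by (intro sum.group[symmetric]) (auto simp: finite_word_colorings assms)
  also have "\<dots> = (\<Sum>i\<in>C. word_sum_start x C i (e # es))"
    unfolding word_sum_start_def
    by (intro sum.cong) (auto simp: starts_with_def word_colorings_def)
  finally show ?thesis .
qed

text \<open>Unrolls \<open>word_sum_start_Cons\<close>. The term for \<open>k\<close> belongs to
  words whose first \<open>k + 1\<close> switched letters all equal \<open>i\<close>, with no
  condition where the remaining word begins.\<close>

lemma word_sum_start_expand:
  assumes "finite C" "uminus ` C = C" "i \<in> C"
  shows "word_sum_start x C i es = (\<Sum>k<length es.
     (- 1) ^ k * (\<Prod>e\<leftarrow>take (Suc k) es. x (sgn_of e * i)) * word_sum x C (drop (Suc k) es))"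
proof (induction es)
  case Nil
  have "{cs. cs \<in> word_colorings C [] \<and> starts_with [] i cs} = {}"
    by (auto simp: word_colorings_def starts_with_def)
  then show ?case
    by (simp only: word_sum_start_def) simp
next
  case (Cons e es)
  show ?case
    by (simp add: word_sum_start_Cons assms Cons sum.lessThan_Suc_shift algebra_simps sum_negf
        sum_distrib_left del: sum.lessThan_Suc)
qed

text \<open>Expands to a sum over all ways of cutting the list into non-empty segments. The first
  segment has length \<open>k + 1\<close>; what follows it is \<open>drop k es\<close> because
  \<open>e\<close> has already been split off.\<close>

function segment_sum :: "(bool list \<Rightarrow> 'a::comm_ring_1) \<Rightarrow> bool list \<Rightarrow> 'a" where
  "segment_sum p [] = 1"
| "segment_sum p (e # es)
     = (\<Sum>k\<le>length es. p (take (Suc k) (e # es)) * segment_sum p (drop k es))"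
  by pat_completeness auto
termination
  by (relation "measure (length \<circ> snd)") auto

text \<open>Summing the expansion over the first letter \<open>i\<close> turns each initial segment
  into a signed power sum. The bound \<open>n\<close> is there because the values of the variables
  can be chosen for bounded lengths only.\<close>

lemma word_sum_eq_segment_sum:
  assumes "finite C" "uminus ` C = C"
    and p: "\<And>s. s \<noteq> [] \<Longrightarrow> length s \<le> n \<Longrightarrow>
      p s = (- 1) ^ (length s - 1) * (\<Sum>i\<in>C. \<Prod>e\<leftarrow>s. x (sgn_of e * i))"
    and "length es \<le> n"
  shows "word_sum x C es = segment_sum p es"
  using assms(4)
proof (induction es rule: length_induct)
  case (1 es)
  show ?case
  proof (cases es)
    case Nil
    have "word_colorings C [] = {[]}"
      by (auto simp: word_colorings_def sign_proper_def)
    then show ?thesis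
      using Nil by (simp add: word_sum_def)
  next
    case (Cons e es')
    have "word_sum x C es = (\<Sum>i\<in>C. \<Sum>k\<le>length es'.
        (- 1) ^ k * (\<Prod>e\<leftarrow>take (Suc k) es. x (sgn_of e * i)) * word_sum x C (drop (Suc k) es))"
      using assms(1,2) by (simp add: Cons word_sum_Cons word_sum_start_expand lessThan_Suc_atMost)
    also have "\<dots> = (\<Sum>k\<le>length es'. (- 1) ^ k *
        (\<Sum>i\<in>C. \<Prod>e\<leftarrow>take (Suc k) es. x (sgn_of e * i)) * word_sum x C (drop (Suc k) es))"
      by (subst sum.swap) (simp add: sum_distrib_left sum_distrib_right)
    also have "\<dots> = (\<Sum>k\<le>length es'. p (take (Suc k) es) * segment_sum p (drop (Suc k) es))"
    proof (intro sum.cong refl)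
      fix k assume "k \<in> {..length es'}"
      then have "length (take (Suc k) es) = Suc k" "take (Suc k) es \<noteq> []"
        using Cons by auto
      moreover have "word_sum x C (drop (Suc k) es) = segment_sum p (drop (Suc k) es)"
        using 1 Cons by simp
      ultimately show "(- 1) ^ k * (\<Sum>i\<in>C. \<Prod>e\<leftarrow>take (Suc k) es. x (sgn_of e * i))
          * word_sum x C (drop (Suc k) es) = p (take (Suc k) es) * segment_sum p (drop (Suc k) es)"
        using p[of "take (Suc k) es"] 1 Cons \<open>k \<in> _\<close> by simp
    qed
    finally show ?thesis
      using Cons by simp
  qed
qed

section \<open>The sign word of a signed path\<close>

fun path_word :: "bool \<Rightarrow> nat list \<Rightarrow> bool list" where
  "path_word b [] = []"
| "path_word b (a # \<alpha>) = replicate a b @ path_word (\<not> b) \<alpha>"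

fun path_vertices :: "nat \<Rightarrow> nat list \<Rightarrow> (nat \<times> nat) list" where
  "path_vertices i [] = []"
| "path_vertices i (a # \<alpha>) = map (Pair i) [0..<a] @ path_vertices (Suc i) \<alpha>"

lemma set_path_vertices:
  "(k, j) \<in> set (path_vertices i \<alpha>) \<longleftrightarrow> i \<le> k \<and> k < i + length \<alpha> \<and> j < \<alpha> ! (k - i)"
proof (induction i \<alpha> rule: path_vertices.induct)
  case (2 i a \<alpha>)
  have "(a # \<alpha>) ! (k - i) = \<alpha> ! (k - Suc i)" if "Suc i \<le> k"
    using that by (simp add: nth_Cons')
  then show ?case
    using 2 by (cases "k = i") auto
qed simp

lemma distinct_path_vertices: "distinct (path_vertices i \<alpha>)"
proof (induction i \<alpha> rule: path_vertices.induct)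
  case (2 i a \<alpha>)
  then show ?case
    by (auto simp: distinct_map inj_on_def set_path_vertices)
qed simp

lemma length_path_word: "length (path_word b \<alpha>) = length (path_vertices i \<alpha>)"
  by (induction i \<alpha> arbitrary: b rule: path_vertices.induct) auto

lemma successively_upt: "successively P (map f [0..<n]) \<longleftrightarrow> (\<forall>j. Suc j < n \<longrightarrow> P (f j) (f (Suc j)))"
  by (induction n) (auto simp: successively_append_iff less_Suc_eq_le le_less last_map)

text \<open>Vertices of one run carry the same sign, which cancels; across a negative edge the signs
  are opposite, which turns distinctness into \<open>c \<noteq> - d\<close>. The start index and the
  first sign are arbitrary for the sake of the induction.\<close>

lemma sign_proper_path_iff:
  assumes "\<forall>a\<in>set \<alpha>. 0 < a"
  shows "sign_proper (path_word b \<alpha>) (map \<kappa> (path_vertices i \<alpha>)) \<longleftrightarrow>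
    (\<forall>k<length \<alpha>. \<forall>j. Suc j < \<alpha> ! k \<longrightarrow> \<kappa> (i + k, j) \<noteq> \<kappa> (i + k, Suc j)) \<and>
    (\<forall>k. Suc k < length \<alpha> \<longrightarrow> \<kappa> (i + k, \<alpha> ! k - 1) \<noteq> - \<kappa> (i + Suc k, 0))"
  using assms
proof (induction i \<alpha> arbitrary: b rule: path_vertices.induct)
  case (1 i)
  show ?case by (simp add: sign_proper_def)
next
  case (2 i a \<alpha>)
  define Z where "Z = zip (path_word (\<not> b) \<alpha>) (map \<kappa> (path_vertices (Suc i) \<alpha>))"
  have zip: "zip (path_word b (a # \<alpha>)) (map \<kappa> (path_vertices i (a # \<alpha>)))
      = map (\<lambda>j. (b, \<kappa> (i, j))) [0..<a] @ Z"
  proof -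
    have "zip (replicate a b) (map \<kappa> (map (Pair i) [0..<a])) = map (\<lambda>j. (b, \<kappa> (i, j))) [0..<a]"
      by (intro nth_equalityI) auto
    then show ?thesis
      unfolding Z_def path_word.simps path_vertices.simps map_append by (subst zip_append) auto
  qed
  have hd: "hd Z = (\<not> b, \<kappa> (Suc i, 0))"
    if "\<alpha> \<noteq> []"
  proof -
    from that 2 obtain a' \<alpha>' where "\<alpha> = Suc a' # \<alpha>'"
      by (cases \<alpha>) (auto simp: gr0_conv_Suc)
    then show ?thesis
      by (simp add: Z_def upt_conv_Cons del: upt_Suc)
  qed
  have nil: "Z = [] \<longleftrightarrow> \<alpha> = []"
  proof (cases \<alpha>)
    case (Cons a' \<alpha>')
    with 2 show ?thesis by (cases a') (auto simp: Z_def upt_conv_Cons simp del: upt_Suc)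
  qed (simp add: Z_def)
  have inj: "sgn_of b \<noteq> 0" "sgn_of (\<not> b) = - sgn_of b"
    "- (sgn_of b * c) = - sgn_of b * d \<longleftrightarrow> c = d"
    "sgn_of b * c = - (sgn_of b * d) \<longleftrightarrow> c = - d" for c d
    by (auto simp: sgn_of_def)
  have ex: "(\<forall>k<Suc n. P k) \<longleftrightarrow> P 0 \<and> (\<forall>k<n. P (Suc k))" for P n
    using less_Suc_eq_0_disj by auto
  have ex': "(\<forall>k. Suc k < Suc n \<longrightarrow> P k) \<longleftrightarrow> (n \<noteq> 0 \<longrightarrow> P 0) \<and> (\<forall>k. Suc k < n \<longrightarrow> P (Suc k))" for P n
    by (metis Suc_less_eq gr0_conv_Suc neq0_conv not0_implies_Suc)
  have "0 < a" using 2 by simp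
  then have last: "last (map (\<lambda>j. (b, \<kappa> (i, j))) [0..<a]) = (b, \<kappa> (i, a - 1))"
    by (simp add: last_map)
  have "sign_proper (path_word b (a # \<alpha>)) (map \<kappa> (path_vertices i (a # \<alpha>))) \<longleftrightarrow>
      (\<forall>j. Suc j < a \<longrightarrow> \<kappa> (i, j) \<noteq> \<kappa> (i, Suc j)) \<and>
      sign_proper (path_word (\<not> b) \<alpha>) (map \<kappa> (path_vertices (Suc i) \<alpha>)) \<and>
      (\<alpha> \<noteq> [] \<longrightarrow> \<kappa> (i, a - 1) \<noteq> - \<kappa> (Suc i, 0))"
    using \<open>0 < a\<close> hd last unfolding sign_proper_def zip Z_def[symmetric]
    by (auto simp: successively_append_iff nil inj successively_upt)
  then show ?case
    using 2 by (simp only: length_Cons ex ex' nth_Cons_0 nth_Cons_Suc) auto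
qed

lemma verts_signed_path: "verts (signed_path \<alpha>) = set (path_vertices 0 \<alpha>)"
  by (auto simp: signed_path_def set_path_vertices)

lemma proper_colorings_signed_path:
  assumes "composition \<alpha>"
  shows "\<kappa> \<in> proper_colorings (signed_path \<alpha>) \<longleftrightarrow>
    \<kappa> \<in> extensional (set (path_vertices 0 \<alpha>)) \<and>
    sign_proper (path_word b \<alpha>) (map \<kappa> (path_vertices 0 \<alpha>))"
proof -
  have "\<kappa> \<in> proper_colorings (signed_path \<alpha>) \<longleftrightarrow> \<kappa> \<in> extensional (set (path_vertices 0 \<alpha>)) \<and>
    (\<forall>k<length \<alpha>. \<forall>j. Suc j < \<alpha> ! k \<longrightarrow> \<kappa> (k, j) \<noteq> \<kappa> (k, Suc j)) \<and>
    (\<forall>k. Suc k < length \<alpha> \<longrightarrow> \<kappa> (k, \<alpha> ! k - 1) \<noteq> - \<kappa> (Suc k, 0))"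
  proof -
    have "(\<forall>v w. {v, w} \<in> pos_edges (signed_path \<alpha>) \<longrightarrow> \<kappa> v \<noteq> \<kappa> w)
      \<longleftrightarrow> (\<forall>k<length \<alpha>. \<forall>j. Suc j < \<alpha> ! k \<longrightarrow> \<kappa> (k, j) \<noteq> \<kappa> (k, Suc j))"
      unfolding signed_path_def by (simp add: doubleton_eq_iff) metis
    moreover have "(\<forall>v w. {v, w} \<in> neg_edges (signed_path \<alpha>) \<longrightarrow> \<kappa> v \<noteq> - \<kappa> w)
      \<longleftrightarrow> (\<forall>k. Suc k < length \<alpha> \<longrightarrow> \<kappa> (k, \<alpha> ! k - 1) \<noteq> - \<kappa> (Suc k, 0))"
      unfolding signed_path_def by (simp add: doubleton_eq_iff) (metis minus_equation_iff)
    moreover have "loops (signed_path \<alpha>) = {}"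
      by (simp add: signed_path_def)
    ultimately show ?thesis
      unfolding proper_colorings_def verts_signed_path by (simp add: PiE_def)
  qed
  then show ?thesis
    using assms sign_proper_path_iff[of \<alpha> b \<kappa> 0] by (auto simp: composition_def)
qed

text \<open>Listing the colors along the path is a bijection from extensional colorings to lists,
  since \<open>path_vertices\<close> enumerates the vertices without repetition.\<close>

lemma sum_colorings_signed_path:
  fixes x :: "int \<Rightarrow> 'a :: comm_ring_1"
  assumes "composition \<alpha>"
  shows "(\<Sum>\<kappa> | \<kappa> \<in> proper_colorings (signed_path \<alpha>) \<and> \<kappa> ` verts (signed_path \<alpha>) \<subseteq> C.
      \<Prod>v\<in>verts (signed_path \<alpha>). x (\<kappa> v)) = word_sum x C (path_word b \<alpha>)"
proof -
  let ?vs = "path_vertices 0 \<alpha>"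
  show ?thesis
    unfolding word_sum_def verts_signed_path
  proof (rule sum.reindex_bij_witness)
    let ?inv = "\<lambda>cs. restrict (the \<circ> map_of (zip ?vs cs)) (set ?vs)"
    show "map \<kappa> ?vs \<in> word_colorings C (path_word b \<alpha>)"
      if "\<kappa> \<in> {\<kappa>. \<kappa> \<in> proper_colorings (signed_path \<alpha>) \<and> \<kappa> ` set ?vs \<subseteq> C}" for \<kappa>
      using that proper_colorings_signed_path[OF assms]
      by (auto simp: word_colorings_def length_path_word[of _ _ 0])
    show "?inv (map \<kappa> ?vs) = \<kappa>"
      if "\<kappa> \<in> {\<kappa>. \<kappa> \<in> proper_colorings (signed_path \<alpha>) \<and> \<kappa> ` set ?vs \<subseteq> C}" for \<kappa>
      using that proper_colorings_signed_path[OF assms, of \<kappa> b]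
      by (intro ext) (auto simp: map_of_zip_map restrict_def extensional_def simp del: split_paired_All)
    have map_inv: "map (?inv cs) ?vs = cs" if "length cs = length ?vs" for cs
      using that distinct_path_vertices[of 0 \<alpha>]
      by (intro nth_equalityI) (auto simp: map_of_zip_nth)
    show "map (?inv cs) ?vs = cs" if "cs \<in> word_colorings C (path_word b \<alpha>)" for cs
      using that by (intro map_inv) (simp add: word_colorings_def length_path_word[of _ _ 0])
    show "?inv cs \<in> {\<kappa>. \<kappa> \<in> proper_colorings (signed_path \<alpha>) \<and> \<kappa> ` set ?vs \<subseteq> C}"
      if "cs \<in> word_colorings C (path_word b \<alpha>)" for cs
    proof -
      have "map (?inv cs) ?vs = cs"
        using that by (intro map_inv) (simp add: word_colorings_def length_path_word[of _ _ 0])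
      moreover from this have "?inv cs ` set ?vs = set cs"
        by (metis set_map)
      ultimately show ?thesis
        using that proper_colorings_signed_path[OF assms, of "?inv cs" b]
        by (simp add: word_colorings_def)
    qed
    show "(\<Prod>c\<leftarrow>map \<kappa> ?vs. x c) = (\<Prod>v\<in>set ?vs. x (\<kappa> v))" for \<kappa>
      by (simp add: prod.distinct_set_conv_list distinct_path_vertices comp_def)
  qed
qed

section \<open>Choosing the values of the variables\<close>

definition constant_word :: "bool list \<Rightarrow> bool" where
  "constant_word s \<longleftrightarrow> (\<exists>b. set s \<subseteq> {b})"

text \<open>Two families of colors are combined: one sees constant words only, the other sees only
  the length of a word.\<close>

lemma ex_letter_values:
  fixes g h :: "nat \<Rightarrow> complex"
  obtains C :: "int set" and x :: "int \<Rightarrow> complex"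
  where "finite C" "uminus ` C = C"
    and "\<And>s. s \<noteq> [] \<Longrightarrow> length s \<le> n \<Longrightarrow> (\<Sum>i\<in>C. \<Prod>e\<leftarrow>s. x (sgn_of e * i))
      = (if constant_word s then g (length s) else 0) + h (length s)"
proof -
  obtain ys where ys: "\<And>m. 0 < m \<Longrightarrow> m \<le> n \<Longrightarrow> (\<Sum>y\<leftarrow>ys. y ^ m) = g m"
    using ex_power_sums[of n g] by blast
  \<comment> \<open>Half of \<open>h\<close>, because each \<open>w\<close> will be the value of two
    opposite colors.\<close>
  obtain ws where ws: "\<And>m. 0 < m \<Longrightarrow> m \<le> n \<Longrightarrow> (\<Sum>w\<leftarrow>ws. w ^ m) = h m / 2"
    using ex_power_sums[of n "\<lambda>m. h m / 2"] by blast
  let ?A = "length ys" and ?B = "length ws"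
  \<comment> \<open>A pair of colors with values \<open>(y, 0)\<close> contributes \<open>y ^ length s\<close> to constant words \<open>s\<close>
    only; a pair with values \<open>(w, w)\<close> contributes \<open>2 * w ^ length s\<close> to all words.\<close>
  define up where "up k = (ys @ ws) ! k" for k
  define dn where "dn k = (if k < ?A then 0 else (ys @ ws) ! k)" for k
  define x where "x i = (if i = 0 then 0 else if 0 < i then up (nat i - 1) else dn (nat (- i) - 1))"
    for i :: int
  define C where "C = {- int (?A + ?B)..int (?A + ?B)}"
  have "finite C" "uminus ` C = C"
    by (auto simp: C_def)
  moreover have "(\<Sum>i\<in>C. \<Prod>e\<leftarrow>s. x (sgn_of e * i))
      = (if constant_word s then g (length s) else 0) + h (length s)"
    if s: "s \<noteq> []" "length s \<le> n" for s
  proof -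
    define f where "f i = (\<Prod>e\<leftarrow>s. x (sgn_of e * i))" for i
    have C: "C = insert 0 ((\<lambda>k. int k + 1) ` {..<?A + ?B} \<union> (\<lambda>k. - (int k + 1)) ` {..<?A + ?B})"
    proof (intro set_eqI iffI)
      fix i assume "i \<in> C"
      then have "i = 0 \<or> i = int (nat (i - 1)) + 1 \<and> nat (i - 1) < ?A + ?B
          \<or> i = - (int (nat (- i - 1)) + 1) \<and> nat (- i - 1) < ?A + ?B"
        by (auto simp: C_def)
      then show "i \<in> insert 0 ((\<lambda>k. int k + 1) ` {..<?A + ?B} \<union> (\<lambda>k. - (int k + 1)) ` {..<?A + ?B})"
        by blast
    qed (auto simp: C_def)
    have nat_pred: "nat (int k + 1) - 1 = k" for k
      by simp
    have x: "x (sgn_of e * (int k + 1)) = (if e then up k else dn k)"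
        "x (sgn_of e * - (int k + 1)) = (if e then dn k else up k)" for e k
      unfolding x_def sgn_of_def by (auto simp: nat_pred simp del: One_nat_def minus_add_distrib)
    have split: "(\<Sum>k<a + b. F k) = (\<Sum>k<a. F k) + (\<Sum>k<b. F (k + a))"
      for a b and F :: "nat \<Rightarrow> complex"
      by (induction b) (simp_all add: add.assoc add.commute[of a])
    \<comment> \<open>The color 0 has value 0, and \<open>s\<close> is not empty.\<close>
    have "f 0 = 0"
      using s by (cases s) (auto simp: f_def x_def)
    have "(\<Sum>i\<in>C. f i)
        = (\<Sum>i\<in>(\<lambda>k. int k + 1) ` {..<?A + ?B} \<union> (\<lambda>k. - (int k + 1)) ` {..<?A + ?B}. f i)"
      using \<open>f 0 = 0\<close> unfolding C by (subst sum.insert) auto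
    also have "\<dots> = (\<Sum>k<?A + ?B. f (int k + 1)) + (\<Sum>k<?A + ?B. f (- (int k + 1)))"
      by (subst sum.union_disjoint) (auto simp: sum.reindex inj_on_def)
    also have "\<dots> = (\<Sum>k<?A + ?B. f (int k + 1) + f (- (int k + 1)))"
      by (simp add: sum.distrib)
    also have "\<dots> = (\<Sum>k<?A. f (int k + 1) + f (- (int k + 1)))
        + (\<Sum>k<?B. f (int (k + ?A) + 1) + f (- (int (k + ?A) + 1)))"
      by (rule split)
    also have "(\<Sum>k<?A. f (int k + 1) + f (- (int k + 1)))
        = (\<Sum>k<?A. if constant_word s then ys ! k ^ length s else 0)"
    proof (intro sum.cong refl)
      fix k assume "k \<in> {..<?A}"
      then have f: "f (int k + 1) = (\<Prod>e\<leftarrow>s. if e then ys ! k else 0)"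
          "f (- (int k + 1)) = (\<Prod>e\<leftarrow>s. if e then 0 else ys ! k)"
        unfolding f_def x
        by (auto simp: up_def dn_def nth_append intro!: arg_cong[of _ _ prod_list])
      have t: "(\<Prod>e\<leftarrow>r. if e then ys ! k else 0) = (if False \<in> set r then 0 else ys ! k ^ length r)"
          "(\<Prod>e\<leftarrow>r. if e then 0 else ys ! k) = (if True \<in> set r then 0 else ys ! k ^ length r)" for r
        by (induction r) auto
      \<comment> \<open>For constant \<open>s\<close> one of the two opposite colors contributes
        \<open>ys ! k ^ length s\<close> and the other 0; otherwise both contribute 0.\<close>
      have "constant_word s \<longleftrightarrow> False \<notin> set s \<or> True \<notin> set s"
        unfolding constant_word_def by (metis (full_types) empty_iff insert_iff subset_eq)
      moreover have "False \<in> set s \<or> True \<in> set s"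
        using s by (cases s) auto
      ultimately show "f (int k + 1) + f (- (int k + 1)) = (if constant_word s then ys ! k ^ length s else 0)"
        unfolding f t by auto
    qed
    also have "\<dots> = (if constant_word s then g (length s) else 0)"
      using ys[of "length s"] s by (simp add: sum_list_sum_nth atLeast0LessThan)
    also have "(\<Sum>k<?B. f (int (k + ?A) + 1) + f (- (int (k + ?A) + 1))) = (\<Sum>k<?B. 2 * ws ! k ^ length s)"
    proof (intro sum.cong refl)
      fix k assume "k \<in> {..<?B}"
      then have "f (int (k + ?A) + 1) = (\<Prod>e\<leftarrow>s. ws ! k)" "f (- (int (k + ?A) + 1)) = (\<Prod>e\<leftarrow>s. ws ! k)"
        unfolding f_def x
        by (auto simp: up_def dn_def nth_append intro!: arg_cong[of _ _ prod_list])
      then show "f (int (k + ?A) + 1) + f (- (int (k + ?A) + 1)) = 2 * ws ! k ^ length s"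
        by (simp add: map_replicate_const)
    qed
    also have "\<dots> = h (length s)"
      using ws[of "length s"] s
      by (simp add: sum_list_sum_nth atLeast0LessThan mult.commute[of _ 2] flip: sum_distrib_left)
    finally show ?thesis
      by (simp add: f_def)
  qed
  ultimately show ?thesis
    using that by blast
qed

lemma segment_sum_cong_chromatic:
  fixes g :: "nat \<Rightarrow> complex"
  assumes "composition \<alpha>" "composition \<beta>" "chromatic (signed_path \<alpha>) = chromatic (signed_path \<beta>)"
  shows "segment_sum (\<lambda>s. (if constant_word s then g (length s) else 0) + t) (path_word True \<alpha>)
       = segment_sum (\<lambda>s. (if constant_word s then g (length s) else 0) + t) (path_word True \<beta>)"
    (is "segment_sum ?p _ = _")
proof -
  define n where "n = max (length (path_word True \<alpha>)) (length (path_word True \<beta>))"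
  \<comment> \<open>The prescribed values carry the sign of the inclusion-exclusion, so that the two
    signs cancel.\<close>
  obtain C x where C: "finite C" "uminus ` C = C"
    and x: "\<And>s. s \<noteq> [] \<Longrightarrow> length s \<le> n \<Longrightarrow> (\<Sum>i\<in>C. \<Prod>e\<leftarrow>s. x (sgn_of e * i))
      = (if constant_word s then (- 1) ^ (length s - 1) * g (length s) else 0)
        + (- 1) ^ (length s - 1) * t"
    using ex_letter_values[of n "\<lambda>m. (- 1) ^ (m - 1) * g m" "\<lambda>m. (- 1) ^ (m - 1) * t"] by metis
  have p: "?p s = (- 1) ^ (length s - 1) * (\<Sum>i\<in>C. \<Prod>e\<leftarrow>s. x (sgn_of e * i))"
    if "s \<noteq> []" "length s \<le> n" for s
    unfolding x[OF that] by (simp add: distrib_left mult.assoc[symmetric] power_mult_distrib[symmetric])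
  have "finite (verts (signed_path \<gamma>))" for \<gamma>
    by (simp add: verts_signed_path)
  then have "word_sum x C (path_word True \<alpha>) = word_sum x C (path_word True \<beta>)"
    using sum_colorings_cong_chromatic[OF _ _ assms(3) C(1), of x]
    unfolding sum_colorings_signed_path[OF assms(1), of _ _ True]
      sum_colorings_signed_path[OF assms(2), of _ _ True]
    by blast
  moreover have "word_sum x C (path_word True \<gamma>) = segment_sum ?p (path_word True \<gamma>)"
    if "\<gamma> = \<alpha> \<or> \<gamma> = \<beta>" for \<gamma>
    using that by (intro word_sum_eq_segment_sum[OF C p]) (auto simp: n_def)
  ultimately show ?thesis
    by simp
qed

section \<open>The linear part of a segment sum\<close>

lemma poly_segment_sum: "poly (segment_sum p es) t = segment_sum (\<lambda>s. poly (p s) t) es"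
  by (induction p es rule: segment_sum.induct) (simp_all add: poly_sum)

lemma coeff_0_segment_sum: "coeff (segment_sum p es) 0 = segment_sum (\<lambda>s. coeff (p s) 0) es"
  by (induction p es rule: segment_sum.induct) (simp_all add: coeff_sum coeff_mult_0)

text \<open>A term of degree 1 arises by choosing one segment, from position \<open>p\<close> to
  \<open>q\<close>, that contributes its indeterminate, while the segments before and after it
  contribute \<open>h\<close>.\<close>

lemma coeff_1_segment_sum:
  "coeff (segment_sum (\<lambda>s. [:h s, 1:]) es) 1
     = (\<Sum>q\<le>length es. \<Sum>p<q. segment_sum h (take p es) * segment_sum h (drop q es))"
proof (induction es rule: length_induct)
  case (1 es)
  let ?W = "segment_sum h"
  show ?case
  proof (cases es)
    case Nil
    then show ?thesis by simp
  next
    case (Cons e es')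
    let ?m = "length es'"
    have "coeff (segment_sum (\<lambda>s. [:h s, 1:]) es) 1
        = (\<Sum>k\<le>?m. h (e # take k es') * coeff (segment_sum (\<lambda>s. [:h s, 1:]) (drop k es')) 1
            + ?W (drop k es'))"
      by (simp add: Cons coeff_sum coeff_0_segment_sum)
    also have "\<dots> = (\<Sum>k\<le>?m. \<Sum>q\<le>?m - k. \<Sum>p<q.
          h (e # take k es') * ?W (take p (drop k es')) * ?W (drop q (drop k es')))
        + (\<Sum>k\<le>?m. ?W (drop k es'))"
      using 1 Cons by (simp add: sum.distrib sum_distrib_left mult.assoc)
    \<comment> \<open>If the chosen segment is not the first, its ends are now measured from the
      start of \<open>es'\<close>; the sum over the first segments then recombines to
      \<open>?W (e # take p es')\<close>.\<close>
    also have "(\<Sum>k\<le>?m. \<Sum>q\<le>?m - k. \<Sum>p<q.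
          h (e # take k es') * ?W (take p (drop k es')) * ?W (drop q (drop k es')))
        = (\<Sum>q\<le>?m. \<Sum>p<q. \<Sum>k\<le>p.
          h (e # take k es') * ?W (take (p - k) (drop k es')) * ?W (drop q es'))"
      by (simp add: sum.Sigma,
          rule sum.reindex_bij_witness[of _ "\<lambda>(q, p, k). (k, q - k, p - k)"
            "\<lambda>(k, q, p). (q + k, p + k, k)"])
        (auto simp: add.commute)
    also have "\<dots> = (\<Sum>q\<le>?m. \<Sum>p<q. ?W (e # take p es') * ?W (drop q es'))"
    proof (intro sum.cong refl)
      fix q p assume "q \<in> {..?m}" "p \<in> {..<q}"
      then have "?W (e # take p es') = (\<Sum>k\<le>p. h (e # take k es') * ?W (take (p - k) (drop k es')))"
        by (simp add: drop_take)
      then show "(\<Sum>k\<le>p. h (e # take k es') * ?W (take (p - k) (drop k es')) * ?W (drop q es'))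
          = ?W (e # take p es') * ?W (drop q es')"
        by (simp add: sum_distrib_right)
    qed
    \<comment> \<open>The cuts in which the first segment is the chosen one supply the terms with
      \<open>p = 0\<close>.\<close>
    also have "\<dots> + (\<Sum>k\<le>?m. ?W (drop k es'))
        = (\<Sum>q\<le>?m. \<Sum>p<Suc q. ?W (take p es) * ?W (drop (Suc q) es))"
      unfolding sum.lessThan_Suc_shift by (simp add: Cons sum.distrib add.commute)
    also have "\<dots> = (\<Sum>q\<le>length es. \<Sum>p<q. ?W (take p es) * ?W (drop q es))"
      by (simp only: Cons list.size add_Suc_right add_0_right sum.atMost_Suc_shift) simp
    finally show ?thesis .
  qed
qed

section \<open>Run lengths\<close>

fun run_lengths :: "'a list \<Rightarrow> nat list" where
  "run_lengths [] = []"
| "run_lengths (x # xs) = (if xs \<noteq> [] \<and> hd xs = x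
     then Suc (hd (run_lengths xs)) # tl (run_lengths xs) else 1 # run_lengths xs)"

lemma run_lengths_eq_Nil_iff [simp]: "run_lengths w = [] \<longleftrightarrow> w = []"
  by (cases w) auto

lemma run_lengths_replicate_append:
  assumes "0 < a" "w = [] \<or> hd w \<noteq> b"
  shows "run_lengths (replicate a b @ w) = a # run_lengths w"
  using assms(1)
proof (induction a)
  case (Suc a)
  show ?case
  proof (cases a)
    case 0
    then show ?thesis using assms(2) by auto
  next
    case (Suc a')
    then show ?thesis using Suc.IH by (auto simp: hd_append)
  qed
qed simp

lemma run_induct [case_names Nil run]:
  assumes "P []"
    and "\<And>a b w. 0 < a \<Longrightarrow> w = [] \<or> hd w \<noteq> b \<Longrightarrow> P w \<Longrightarrow> P (replicate a b @ w)"
  shows "P w"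
proof (induction w rule: length_induct)
  case (1 w)
  show ?case
  proof (cases w)
    case Nil
    then show ?thesis using assms(1) by simp
  next
    case (Cons b w')
    let ?u = "takeWhile (\<lambda>c. c = b) w" and ?v = "dropWhile (\<lambda>c. c = b) w"
    have "?u = replicate (length ?u) b"
      by (intro replicate_eqI) (auto dest: set_takeWhileD)
    then have "w = replicate (length ?u) b @ ?v"
      by (metis takeWhile_dropWhile_id)
    moreover have "0 < length ?u"
      using Cons by simp
    moreover have "?v = [] \<or> hd ?v \<noteq> b"
      using hd_dropWhile[of "\<lambda>c. c = b" w] by blast
    moreover have "length ?v < length w"
      using Cons by (simp add: length_dropWhile_le le_imp_less_Suc)
    then have "P ?v"
      using 1 by blast
    ultimately show ?thesis
      using assms(2)[of "length ?u" ?v b] by simp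
  qed
qed

lemma run_lengths_pos: "a \<in> set (run_lengths w) \<Longrightarrow> 0 < a"
  by (induction w rule: run_induct) (auto simp: run_lengths_replicate_append)

text \<open>Prepending a letter adds one run or none, and concatenation may merge two runs at the
  junction.\<close>

lemma length_run_lengths_append:
  "length (run_lengths (u @ v)) \<le> length (run_lengths u) + length (run_lengths v)"
  "length (run_lengths v) \<le> length (run_lengths (u @ v))"
proof -
  have len: "length (run_lengths (x # xs))
      = (if xs \<noteq> [] \<and> hd xs = x then 0 else 1) + length (run_lengths xs)"
    for x :: 'a and xs
    by (cases "run_lengths xs") auto
  show "length (run_lengths (u @ v)) \<le> length (run_lengths u) + length (run_lengths v)"
  proof (induction u)
    case (Cons x u)
    then show ?case by (cases u) (auto simp: len simp del: run_lengths.simps(2))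
  qed simp
  show "length (run_lengths v) \<le> length (run_lengths (u @ v))"
    by (induction u) (auto simp: len simp del: run_lengths.simps(2))
qed

lemma hd_path_word: "\<forall>a\<in>set \<alpha>. 0 < a \<Longrightarrow> path_word b \<alpha> \<noteq> [] \<Longrightarrow> hd (path_word b \<alpha>) = b"
  by (cases \<alpha>) (auto simp: hd_append gr0_conv_Suc)

lemma run_lengths_path_word: "\<forall>a\<in>set \<alpha>. 0 < a \<Longrightarrow> run_lengths (path_word b \<alpha>) = \<alpha>"
proof (induction \<alpha> arbitrary: b)
  case (Cons a \<alpha>)
  then show ?case
    using run_lengths_replicate_append[of a "path_word (\<not> b) \<alpha>" b] hd_path_word[of \<alpha> "\<not> b"] by auto
qed simp

context
  fixes g G :: "nat \<Rightarrow> 'a :: comm_ring_1"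
  assumes G0: "G 0 = 1"
    and G: "\<And>m. 0 < m \<Longrightarrow> (\<Sum>k<m. g (Suc k) * G (m - Suc k)) = G m"
begin

text \<open>A first segment that leaves the first run is not constant and has weight 0. One of
  length \<open>k + 1\<close> inside the run leaves a run of length \<open>a - (k + 1)\<close>, and
  the relation between \<open>g\<close> and \<open>G\<close> sums up these cases.\<close>

lemma segment_sum_replicate_append:
  assumes "w = [] \<or> hd w \<noteq> b"
  shows "segment_sum (\<lambda>s. if constant_word s then g (length s) else 0) (replicate a b @ w)
       = G a * segment_sum (\<lambda>s. if constant_word s then g (length s) else 0) w"
    (is "?W (replicate a b @ w) = _")
proof (induction a rule: less_induct)
  case (less a)
  show ?case
  proof (cases a)
    case 0
    then show ?thesis by (simp add: G0)
  next
    case (Suc a')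
    let ?h = "\<lambda>s. if constant_word s then g (length s) else 0"
    have "?W (replicate a b @ w) = (\<Sum>k\<le>a' + length w.
        ?h (take (Suc k) (b # replicate a' b @ w)) * ?W (drop k (replicate a' b @ w)))"
      by (simp add: Suc)
    also have "\<dots> = (\<Sum>k\<le>a'.
        ?h (take (Suc k) (b # replicate a' b @ w)) * ?W (drop k (replicate a' b @ w)))"
    proof (intro sum.mono_neutral_right ballI)
      fix k assume k: "k \<in> {..a' + length w} - {..a'}"
      then obtain c w' where w: "w = c # w'"
        by (cases w) auto
      then have "c \<in> set (take (Suc k) (b # replicate a' b @ w))"
          "b \<in> set (take (Suc k) (b # replicate a' b @ w))"
        using k by (auto simp: take_Cons')
      then have "\<not> constant_word (take (Suc k) (b # replicate a' b @ w))"
        using w assms unfolding constant_word_def by auto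
      then show "?h (take (Suc k) (b # replicate a' b @ w)) * ?W (drop k (replicate a' b @ w)) = 0"
        by simp
    qed auto
    also have "\<dots> = (\<Sum>k<a. g (Suc k) * G (a - Suc k) * ?W w)"
    proof (intro sum.cong)
      fix k assume "k \<in> {..<a}"
      then have k: "k \<le> a'" using Suc by simp
      then have "take (Suc k) (b # replicate a' b @ w) = replicate (Suc k) b"
        by (simp add: min_def)
      moreover have "constant_word (replicate (Suc k) b)"
        by (auto simp: constant_word_def)
      moreover have "drop k (replicate a' b @ w) = replicate (a' - k) b @ w"
        using k by simp
      moreover have "?W (replicate (a' - k) b @ w) = G (a' - k) * ?W w"
        using Suc by (intro less) simp
      ultimately show "?h (take (Suc k) (b # replicate a' b @ w)) * ?W (drop k (replicate a' b @ w))
          = g (Suc k) * G (a - Suc k) * ?W w"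
        using Suc by (simp only: length_replicate if_True diff_Suc_Suc mult.assoc)
    qed (use Suc in auto)
    also have "\<dots> = G a * ?W w"
      using G[of a] Suc by (simp flip: sum_distrib_right)
    finally show ?thesis .
  qed
qed

lemma segment_sum_eq_prod_run_lengths:
  "segment_sum (\<lambda>s. if constant_word s then g (length s) else 0) w = (\<Prod>a\<leftarrow>run_lengths w. G a)"
proof (induction w rule: run_induct)
  case (run a b w)
  then show ?case
    by (simp add: segment_sum_replicate_append run_lengths_replicate_append)
qed simp

end

section \<open>Products of weights over runs\<close>

definition run_prod :: "(nat \<Rightarrow> 'a::comm_ring_1) \<Rightarrow> 'b list \<Rightarrow> 'a" where
  "run_prod G w = (\<Prod>a\<leftarrow>run_lengths w. G a)"

lemma run_prod_cong_chromatic: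
  fixes G :: "nat \<Rightarrow> complex"
  assumes "composition \<alpha>" "composition \<beta>" "chromatic (signed_path \<alpha>) = chromatic (signed_path \<beta>)"
  defines "u \<equiv> path_word True \<alpha>" and "v \<equiv> path_word True \<beta>"
  shows "run_prod G u = run_prod G v"
    and "(\<Sum>q\<le>length u. \<Sum>p<q. run_prod G (take p u) * run_prod G (drop q u))
       = (\<Sum>q\<le>length v. \<Sum>p<q. run_prod G (take p v) * run_prod G (drop q v))"
proof -
  \<comment> \<open>The weights \<open>g\<close> exist only for value 1 at 0; run lengths are
    positive, so the change does not affect \<open>run_prod G\<close>.\<close>
  let ?G = "G(0 := 1)"
  obtain g where g: "\<And>m. 0 < m \<Longrightarrow> (\<Sum>k<m. g (Suc k) * ?G (m - Suc k)) = ?G m"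
    using ex_prefix_weights[of ?G] by auto
  let ?h = "\<lambda>s. if constant_word s then g (length s) else 0"
  have W: "segment_sum ?h w = run_prod G w" for w
  proof -
    have "segment_sum ?h w = (\<Prod>a\<leftarrow>run_lengths w. ?G a)"
      using g by (intro segment_sum_eq_prod_run_lengths) auto
    also have "\<dots> = run_prod G w"
      unfolding run_prod_def by (intro arg_cong[of _ _ prod_list] map_cong) (auto dest: run_lengths_pos)
    finally show ?thesis .
  qed
  let ?P = "segment_sum (\<lambda>s. [:?h s, 1:])"
  \<comment> \<open>Equality for all \<open>t\<close> gives equality of polynomials in
    \<open>t\<close>, whose coefficients of degree 0 and 1 are the two claims.\<close>
  have "poly (?P u) t = poly (?P v) t" for t
    using segment_sum_cong_chromatic[OF assms(1-3), of g t] by (simp add: poly_segment_sum u_def v_def)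
  then have eq: "?P u = ?P v"
    by (simp add: poly_eq_poly_eq_iff[symmetric] fun_eq_iff)
  show "run_prod G u = run_prod G v"
    using arg_cong[OF eq, of "\<lambda>P. coeff P 0"] by (simp add: coeff_0_segment_sum W)
  show "(\<Sum>q\<le>length u. \<Sum>p<q. run_prod G (take p u) * run_prod G (drop q u))
       = (\<Sum>q\<le>length v. \<Sum>p<q. run_prod G (take p v) * run_prod G (drop q v))"
    using arg_cong[OF eq, of "\<lambda>P. coeff P 1"] unfolding coeff_1_segment_sum W .
qed

text \<open>A new indeterminate attached to each weight records the number of runs as the
  degree.\<close>

lemma run_prod_monomial: "run_prod (\<lambda>a. [:0, G a:]) w = monom (run_prod G w) (length (run_lengths w))"
proof -
  have "[:0, G a:] = monom (G a) 1" for a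
    by (simp add: monom_Suc monom_0)
  then have "(\<Prod>a\<leftarrow>l. [:0, G a:]) = monom (\<Prod>a\<leftarrow>l. G a) (length l)" for l
    by (induction l) (simp_all add: mult_monom flip: one_pCons monom_0)
  then show ?thesis
    unfolding run_prod_def by blast
qed

text \<open>Evaluation only rescales the weights, so an identity valid for all weights lifts to
  polynomials.\<close>

lemma poly_run_prod: "poly (run_prod (\<lambda>a. [:0, G a:]) w) y = run_prod (\<lambda>a. y * G a) w"
proof -
  have "poly (\<Prod>a\<leftarrow>l. [:0, G a:]) y = (\<Prod>a\<leftarrow>l. y * G a)" for l
    by (induction l) simp_all
  then show ?thesis
    unfolding run_prod_def by blast
qed

section \<open>Sums over initial and final pieces of a path\<close>

definition prefix_poly :: "(nat \<Rightarrow> 'a::comm_ring_1) \<Rightarrow> bool list \<Rightarrow> 'a poly" where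
  "prefix_poly G w = (\<Sum>p\<le>length w. run_prod (\<lambda>a. [:0, G a:]) (take p w))"

definition suffix_poly :: "(nat \<Rightarrow> 'a::comm_ring_1) \<Rightarrow> bool list \<Rightarrow> 'a poly" where
  "suffix_poly G w = (\<Sum>q\<le>length w. run_prod (\<lambda>a. [:0, G a:]) (drop q w))"

text \<open>The total weight of the non-empty initial pieces of a run of length
  \<open>a\<close>.\<close>

definition partial_sum :: "(nat \<Rightarrow> 'a::comm_ring_1) \<Rightarrow> nat \<Rightarrow> 'a" where
  "partial_sum G a = (\<Sum>r=1..a. G r)"

text \<open>The terms with \<open>q \<le> p\<close> missing on the left have degree at least the number of runs of \<open>w\<close>.\<close>

lemma coeff_prefix_suffix:
  assumes "j < length (run_lengths w)"
  shows "coeff (\<Sum>q\<le>length w. \<Sum>p<q.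
      run_prod (\<lambda>a. [:0, G a:]) (take p w) * run_prod (\<lambda>a. [:0, G a:]) (drop q w)) j
    = coeff (prefix_poly G w * suffix_poly G w) j"
proof -
  let ?W = "run_prod (\<lambda>a. [:0, G a:])"
  have "coeff (prefix_poly G w * suffix_poly G w) j
      = (\<Sum>q\<le>length w. \<Sum>p\<le>length w. coeff (?W (take p w) * ?W (drop q w)) j)"
    unfolding prefix_poly_def suffix_poly_def sum_product coeff_sum by (rule sum.swap)
  also have "\<dots> = (\<Sum>q\<le>length w. \<Sum>p<q. coeff (?W (take p w) * ?W (drop q w)) j)"
  proof (rule sum.cong[OF refl], rule sum.mono_neutral_right, goal_cases finite subset ball)
    case (ball q)
    show ?case
    proof
      fix p assume "p \<in> {..length w} - {..<q}"
      then have "q \<le> p" by simp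
      \<comment> \<open>As \<open>q \<le> p\<close>, the words \<open>take p w\<close> and
        \<open>drop q w\<close> together cover \<open>w\<close>, so their numbers of runs add up to
        at least that of \<open>w\<close>.\<close>
      have "drop q w = take (p - q) (drop q w) @ drop p w"
        using \<open>q \<le> p\<close> append_take_drop_id[of "p - q" "drop q w"] by simp
      then have "length (run_lengths (drop p w)) \<le> length (run_lengths (drop q w))"
        by (metis length_run_lengths_append(2))
      then have "length (run_lengths w)
          \<le> length (run_lengths (take p w)) + length (run_lengths (drop q w))"
        using length_run_lengths_append(1)[of "take p w" "drop p w"] by simp
      then show "coeff (?W (take p w) * ?W (drop q w)) j = 0"
        using assms by (simp add: run_prod_monomial mult_monom)
    qed
  qed auto
  finally show ?thesis
    by (simp add: coeff_sum)
qed

lemma sum_atMost_split: "(\<Sum>p\<le>a + m. F p) = (\<Sum>p<a. F p) + (\<Sum>p\<le>m. F (a + p))"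
  for F :: "nat \<Rightarrow> 'a :: comm_monoid_add"
  by (induction m) (simp_all add: add.assoc flip: lessThan_Suc_atMost)

lemma run_prod_replicate_append:
  "0 < a \<Longrightarrow> w = [] \<or> hd w \<noteq> b \<Longrightarrow> run_prod G (replicate a b @ w) = G a * run_prod G w"
  by (simp add: run_prod_def run_lengths_replicate_append)

lemma run_prod_replicate: "0 < a \<Longrightarrow> run_prod G (replicate a b) = G a"
  using run_prod_replicate_append[of a "[]" b G] by (simp add: run_prod_def)

lemma run_prod_path_word: "\<forall>a\<in>set \<alpha>. 0 < a \<Longrightarrow> run_prod G (path_word b \<alpha>) = (\<Prod>a\<leftarrow>\<alpha>. G a)"
  by (simp add: run_prod_def run_lengths_path_word)

text \<open>An initial piece is empty, or a non-empty proper part of the first run, or the whole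
  first run followed by an initial piece of the rest.\<close>

lemma prefix_poly_path_word_Cons:
  assumes "0 < a" "\<forall>a\<in>set \<alpha>. 0 < a"
  shows "prefix_poly G (path_word b (a # \<alpha>))
       = 1 + (\<Sum>r=1..<a. [:0, G r:]) + [:0, G a:] * prefix_poly G (path_word (\<not> b) \<alpha>)"
proof -
  let ?w = "path_word (\<not> b) \<alpha>" and ?W = "run_prod (\<lambda>a. [:0, G a:])"
  have "prefix_poly G (path_word b (a # \<alpha>)) = (\<Sum>p<a. ?W (take p (replicate a b @ ?w)))
      + (\<Sum>p\<le>length ?w. ?W (take (a + p) (replicate a b @ ?w)))"
    by (simp add: prefix_poly_def sum_atMost_split)
  also have "(\<Sum>p<a. ?W (take p (replicate a b @ ?w))) = (\<Sum>p<a. ?W (replicate p b))"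
    by (intro sum.cong) (auto simp: min_def)
  also have "{..<a} = insert 0 {1..<a}"
    using assms by auto
  also have "(\<Sum>p\<in>insert 0 {1..<a}. ?W (replicate p b)) = 1 + (\<Sum>r=1..<a. [:0, G r:])"
    by (subst sum.insert) (auto simp: run_prod_replicate intro!: sum.cong, simp add: run_prod_def)
  also have "(\<Sum>p\<le>length ?w. ?W (take (a + p) (replicate a b @ ?w)))
      = (\<Sum>p\<le>length ?w. [:0, G a:] * ?W (take p ?w))"
  proof (intro sum.cong refl)
    fix p
    have "take p ?w = [] \<or> hd (take p ?w) \<noteq> b"
      using hd_path_word[OF assms(2), of "\<not> b"] by (cases "p = 0") (auto simp: hd_take)
    then show "?W (take (a + p) (replicate a b @ ?w)) = [:0, G a:] * ?W (take p ?w)"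
      using assms(1) by (simp only: take_append) (simp add: run_prod_replicate_append)
  qed
  finally show ?thesis
    by (simp add: prefix_poly_def sum_distrib_left)
qed

text \<open>Every final piece that starts inside the first run contains all later runs, so these
  pieces share one degree.\<close>

lemma suffix_poly_path_word_Cons:
  assumes "0 < a" "\<forall>a\<in>set \<alpha>. 0 < a"
  shows "suffix_poly G (path_word b (a # \<alpha>))
       = monom (partial_sum G a * (\<Prod>a\<leftarrow>\<alpha>. G a)) (Suc (length \<alpha>)) + suffix_poly G (path_word (\<not> b) \<alpha>)"
proof -
  let ?w = "path_word (\<not> b) \<alpha>" and ?W = "run_prod (\<lambda>a. [:0, G a:])"
  have "suffix_poly G (path_word b (a # \<alpha>)) = (\<Sum>q<a. ?W (drop q (replicate a b @ ?w)))
      + (\<Sum>q\<le>length ?w. ?W (drop (a + q) (replicate a b @ ?w)))"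
    by (simp add: suffix_poly_def sum_atMost_split)
  also have "(\<Sum>q<a. ?W (drop q (replicate a b @ ?w)))
      = (\<Sum>q<a. monom (G (a - q) * (\<Prod>a\<leftarrow>\<alpha>. G a)) (Suc (length \<alpha>)))"
  proof (intro sum.cong refl)
    fix q assume q: "q \<in> {..<a}"
    have "?w = [] \<or> hd ?w \<noteq> b"
      using hd_path_word[OF assms(2), of "\<not> b"] by auto
    then have "?W (replicate (a - q) b @ ?w) = [:0, G (a - q):] * ?W ?w"
      using q by (intro run_prod_replicate_append) simp
    then have "?W (drop q (replicate a b @ ?w)) = [:0, G (a - q):] * ?W ?w"
      using q by simp
    also have "\<dots> = monom (G (a - q)) 1 * monom (\<Prod>a\<leftarrow>\<alpha>. G a) (length \<alpha>)"
      using assms by (simp add: run_prod_monomial run_prod_path_word run_lengths_path_word monom_Suc monom_0)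
    finally show "?W (drop q (replicate a b @ ?w))
        = monom (G (a - q) * (\<Prod>a\<leftarrow>\<alpha>. G a)) (Suc (length \<alpha>))"
      by (simp add: mult_monom)
  qed
  also have "\<dots> = monom (\<Sum>q<a. G (a - q) * (\<Prod>a\<leftarrow>\<alpha>. G a)) (Suc (length \<alpha>))"
    by (simp add: monom_sum)
  also have "(\<Sum>q<a. G (a - q) * (\<Prod>a\<leftarrow>\<alpha>. G a)) = partial_sum G a * (\<Prod>a\<leftarrow>\<alpha>. G a)"
    unfolding partial_sum_def sum_distrib_right
    by (rule sum.reindex_bij_witness[of _ "\<lambda>r. a - r" "\<lambda>q. a - q"]) auto
  finally show ?thesis
    by (simp add: suffix_poly_def)
qed

text \<open>A piece of degree \<open>k + 1\<close> consists of the first \<open>k\<close> whole runs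
  and a non-empty part of the next one.\<close>

lemma coeff_prefix_poly:
  assumes "\<forall>a\<in>set \<alpha>. 0 < a"
  shows "coeff (prefix_poly G (path_word b \<alpha>)) 0 = 1"
    and "k < length \<alpha> \<Longrightarrow> coeff (prefix_poly G (path_word b \<alpha>)) (Suc k)
      = (\<Prod>a\<leftarrow>take k \<alpha>. G a) * partial_sum G (\<alpha> ! k)"
proof -
  have c0: "coeff (prefix_poly G (path_word b \<alpha>)) 0 = 1" if "\<forall>a\<in>set \<alpha>. 0 < a" for b \<alpha>
    using that
  proof (cases \<alpha>)
    case Nil
    then show ?thesis by (simp add: prefix_poly_def run_prod_def)
  next
    case (Cons a \<alpha>')
    with that have "0 < a" "\<forall>a\<in>set \<alpha>'. 0 < a" by auto
    then show ?thesis
      unfolding Cons by (simp add: prefix_poly_path_word_Cons coeff_sum del: path_word.simps)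
  qed
  show "coeff (prefix_poly G (path_word b \<alpha>)) 0 = 1"
    using assms by (rule c0)
  show "k < length \<alpha> \<Longrightarrow> coeff (prefix_poly G (path_word b \<alpha>)) (Suc k)
      = (\<Prod>a\<leftarrow>take k \<alpha>. G a) * partial_sum G (\<alpha> ! k)"
    using assms
  proof (induction \<alpha> arbitrary: b k)
    case (Cons a \<alpha>)
    then have "0 < a" "\<forall>a\<in>set \<alpha>. 0 < a" by auto
    note rec = prefix_poly_path_word_Cons[OF this, of G b]
    show ?case
    proof (cases k)
      case 0
      \<comment> \<open>The proper parts of the first run come from the sum in \<open>rec\<close>,
        the whole run from the constant term of the remaining prefix polynomial.\<close>
      have "{1..a} = insert a {1..<a}"
        using \<open>0 < a\<close> by auto
      then have "(\<Sum>r=1..<a. G r) + G a = partial_sum G a"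
        by (simp add: partial_sum_def add.commute)
      then show ?thesis
        using 0 c0[of \<alpha> "\<not> b"] Cons.prems unfolding rec by (simp add: coeff_sum)
    next
      case (Suc k')
      then show ?thesis
        using Cons unfolding rec by (simp add: coeff_sum mult.assoc coeff_pCons)
    qed
  qed simp
qed

text \<open>The induction adds runs at the front, which creates terms of a single new degree; the
  value 0 for large \<open>k\<close> says that this degree was empty before.\<close>

lemma coeff_suffix_poly:
  assumes "\<forall>a\<in>set \<alpha>. 0 < a"
  shows "coeff (suffix_poly G (path_word b \<alpha>)) 0 = 1"
    and "coeff (suffix_poly G (path_word b \<alpha>)) (Suc k) = (if k < length \<alpha>
      then (\<Prod>a\<leftarrow>drop (length \<alpha> - k) \<alpha>. G a) * partial_sum G (\<alpha> ! (length \<alpha> - Suc k)) else 0)"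
proof -
  show "coeff (suffix_poly G (path_word b \<alpha>)) 0 = 1"
    using assms
  proof (induction \<alpha> arbitrary: b)
    case Nil
    then show ?case by (simp add: suffix_poly_def run_prod_def)
  next
    case (Cons a \<alpha>)
    then show ?case by (simp add: suffix_poly_path_word_Cons del: path_word.simps)
  qed
  show "coeff (suffix_poly G (path_word b \<alpha>)) (Suc k) = (if k < length \<alpha>
      then (\<Prod>a\<leftarrow>drop (length \<alpha> - k) \<alpha>. G a) * partial_sum G (\<alpha> ! (length \<alpha> - Suc k)) else 0)"
    using assms
  proof (induction \<alpha> arbitrary: b)
    case Nil
    then show ?case by (simp add: suffix_poly_def run_prod_def)
  next
    case (Cons a \<alpha>)
    then have "0 < a" "\<forall>a\<in>set \<alpha>. 0 < a" by auto
    note rec = suffix_poly_path_word_Cons[OF this, of G b]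
    show ?case
      using Cons unfolding rec by (auto simp: Suc_diff_le mult.commute not_less less_Suc_eq)
  qed
qed

text \<open>
  The sum, over the initial pieces of a signed path that meet exactly \<open>k\<close> runs, of the products
  of the weights of their runs; meaningful only for \<open>k \<le> length \<alpha>\<close>.
\<close>

definition outer_sum :: "(nat \<Rightarrow> 'a::comm_ring_1) \<Rightarrow> nat list \<Rightarrow> nat \<Rightarrow> 'a" where
  "outer_sum G \<alpha> k = (case k of 0 \<Rightarrow> 1 | Suc k \<Rightarrow> (\<Prod>a\<leftarrow>take k \<alpha>. G a) * partial_sum G (\<alpha> ! k))"

text \<open>The parts of degree 0 and 1 in \<open>t\<close>, the latter sorted by the number
  \<open>j\<close> of factors. Below the number of runs this second part factors into initial and
  final pieces.\<close>

lemma chromatic_invariants: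
  fixes G :: "nat \<Rightarrow> complex"
  assumes "composition \<alpha>" "composition \<beta>" "chromatic (signed_path \<alpha>) = chromatic (signed_path \<beta>)"
  shows "(\<Prod>a\<leftarrow>\<alpha>. G a) = (\<Prod>a\<leftarrow>\<beta>. G a)"
    and "j < length \<alpha> \<Longrightarrow> j < length \<beta> \<Longrightarrow>
      (\<Sum>i\<le>j. outer_sum G \<alpha> i * outer_sum G (rev \<alpha>) (j - i))
      = (\<Sum>i\<le>j. outer_sum G \<beta> i * outer_sum G (rev \<beta>) (j - i))"
proof -
  let ?w = "path_word True"
  have pos: "\<forall>a\<in>set \<alpha>. 0 < a" "\<forall>a\<in>set \<beta>. 0 < a"
    using assms by (auto simp: composition_def)
  show "(\<Prod>a\<leftarrow>\<alpha>. G a) = (\<Prod>a\<leftarrow>\<beta>. G a)"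
    using run_prod_cong_chromatic(1)[OF assms, of G] pos by (simp add: run_prod_path_word)
  assume j: "j < length \<alpha>" "j < length \<beta>"
  let ?D = "\<lambda>w. \<Sum>q\<le>length w. \<Sum>p<q. run_prod (\<lambda>a. [:0, G a:]) (take p w) * run_prod (\<lambda>a. [:0, G a:]) (drop q w)"
  have "poly (?D (?w \<alpha>)) y = poly (?D (?w \<beta>)) y" for y
    using run_prod_cong_chromatic(2)[OF assms, of "\<lambda>a. y * G a"] by (simp add: poly_sum poly_run_prod)
  then have "?D (?w \<alpha>) = ?D (?w \<beta>)"
    by (simp add: poly_eq_poly_eq_iff[symmetric] fun_eq_iff)
  then have "coeff (prefix_poly G (?w \<alpha>) * suffix_poly G (?w \<alpha>)) j
      = coeff (prefix_poly G (?w \<beta>) * suffix_poly G (?w \<beta>)) j"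
    using coeff_prefix_suffix[of j "?w \<alpha>" G] coeff_prefix_suffix[of j "?w \<beta>" G] j pos
    by (simp add: run_lengths_path_word)
  moreover have "coeff (prefix_poly G (?w \<gamma>) * suffix_poly G (?w \<gamma>)) j
      = (\<Sum>i\<le>j. outer_sum G \<gamma> i * outer_sum G (rev \<gamma>) (j - i))"
    if len: "j < length \<gamma>" and pos: "\<forall>a\<in>set \<gamma>. 0 < a" for \<gamma>
  proof -
    have "coeff (prefix_poly G (?w \<gamma>)) i = outer_sum G \<gamma> i" if "i \<le> j" for i
    proof (cases i)
      case 0
      then show ?thesis by (simp add: outer_sum_def coeff_prefix_poly(1) pos)
    next
      case (Suc k)
      then have "k < length \<gamma>" using that len by simp
      from coeff_prefix_poly(2)[OF pos this] show ?thesis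
        by (simp add: Suc outer_sum_def)
    qed
    \<comment> \<open>Final pieces of \<open>\<gamma>\<close> are initial pieces of
      \<open>rev \<gamma>\<close>.\<close>
    moreover have "coeff (suffix_poly G (?w \<gamma>)) i = outer_sum G (rev \<gamma>) i" if "i \<le> j" for i
    proof (cases i)
      case 0
      then show ?thesis by (simp add: outer_sum_def coeff_suffix_poly(1) pos)
    next
      case (Suc k)
      then have "k < length \<gamma>" using that len by simp
      then show ?thesis
        using coeff_suffix_poly(2)[OF pos, of G True k]
        by (simp add: Suc outer_sum_def take_rev rev_nth flip: rev_map)
    qed
    ultimately show ?thesis
      by (simp add: coeff_mult)
  qed
  ultimately show "(\<Sum>i\<le>j. outer_sum G \<alpha> i * outer_sum G (rev \<alpha>) (j - i))
      = (\<Sum>i\<le>j. outer_sum G \<beta> i * outer_sum G (rev \<beta>) (j - i))"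
    using j pos by simp
qed

section \<open>Compositions with the same invariants\<close>

text \<open>The combinatorial part uses positivity and order, hence real weights.\<close>

lemma outer_sum_of_real:
  "outer_sum (\<lambda>a. complex_of_real (G a)) \<alpha> k = complex_of_real (outer_sum G \<alpha> k)"
proof -
  have "(\<Prod>a\<leftarrow>l. complex_of_real (G a)) = complex_of_real (\<Prod>a\<leftarrow>l. G a)" for l
    by (induction l) simp_all
  then show ?thesis
    by (simp add: outer_sum_def partial_sum_def split: nat.split)
qed

lemma outer_sum_cong:
  assumes "take k \<alpha> = take k \<beta>" "k \<le> length \<alpha>" "k \<le> length \<beta>"
  shows "outer_sum G \<alpha> k = outer_sum G \<beta> k"
proof (cases k)
  case (Suc m)
  have "take m \<alpha> = take m \<beta>"
    using assms(1) Suc by (metis min.absorb1 take_take le_SucI le_refl)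
  moreover have "\<alpha> ! m = \<beta> ! m"
    using assms(1) Suc by (metis lessI nth_take)
  ultimately show ?thesis
    by (simp add: outer_sum_def Suc)
qed (simp add: outer_sum_def)

lemma prod_list_indicator: "(\<Prod>a\<leftarrow>l. if a = c then 2 else 1 :: real) = 2 ^ count (mset l) c"
  by (induction l) simp_all

text \<open>Weight 2 at \<open>c\<close> and 1 elsewhere turns the multiplicity of \<open>c\<close>
  into an exponent. Only positive weights are assumed, because a later application can divide by a
  difference of partial sums only for these.\<close>

lemma mset_eqI_prod_list:
  fixes l l' :: "nat list"
  assumes "\<And>G :: nat \<Rightarrow> real. (\<And>a. 0 < G a) \<Longrightarrow> (\<Prod>a\<leftarrow>l. G a) = (\<Prod>a\<leftarrow>l'. G a)"
  shows "mset l = mset l'"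
proof (rule multiset_eqI)
  fix c
  have "(2::real) ^ count (mset l) c = 2 ^ count (mset l') c"
    using assms[of "\<lambda>a. if a = c then 2 else 1"] by (simp add: prod_list_indicator)
  then show "count (mset l) c = count (mset l') c"
    by simp
qed

lemma partial_sum_strict_mono:
  fixes G :: "nat \<Rightarrow> real"
  assumes "\<And>a. 0 < G a" "a < b"
  shows "partial_sum G a < partial_sum G b"
proof -
  have "{1..b} = {1..a} \<union> {Suc a..b}"
    using assms(2) by auto
  then have "partial_sum G b = partial_sum G a + (\<Sum>r=Suc a..b. G r)"
    by (simp add: partial_sum_def sum.union_disjoint)
  moreover have "0 < (\<Sum>r=Suc a..b. G r)"
    using assms by (intro sum_pos) auto
  ultimately show ?thesis
    by simp
qed

lemma partial_sum_one: "partial_sum (\<lambda>_. 1) a = of_nat a"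
  by (simp add: partial_sum_def)

lemma partial_sum_indicator:
  "0 < c \<Longrightarrow> partial_sum (\<lambda>r. if r = c then 1 else 0) a = (if c \<le> a then 1 else 0)"
  by (simp add: partial_sum_def)

definition same_outer_sums :: "nat list \<Rightarrow> nat list \<Rightarrow> bool" where
  "same_outer_sums \<alpha> \<beta> \<longleftrightarrow> mset \<alpha> = mset \<beta> \<and>
    (\<forall>(G :: nat \<Rightarrow> real) j. j < length \<alpha> \<longrightarrow>
      (\<Sum>i\<le>j. outer_sum G \<alpha> i * outer_sum G (rev \<alpha>) (j - i))
      = (\<Sum>i\<le>j. outer_sum G \<beta> i * outer_sum G (rev \<beta>) (j - i)))"

lemma same_outer_sums_rev: "same_outer_sums \<alpha> \<beta> \<Longrightarrow> same_outer_sums \<alpha> (rev \<beta>)"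
proof -
  have "(\<Sum>i\<le>j. outer_sum G (rev \<beta>) i * outer_sum G \<beta> (j - i))
      = (\<Sum>i\<le>j. outer_sum G \<beta> i * outer_sum G (rev \<beta>) (j - i))" for G :: "nat \<Rightarrow> real" and j
    by (rule sum.reindex_bij_witness[of _ "\<lambda>i. j - i" "\<lambda>i. j - i"]) auto
  then show "same_outer_sums \<alpha> \<beta> \<Longrightarrow> same_outer_sums \<alpha> (rev \<beta>)"
    by (simp add: same_outer_sums_def)
qed

lemma sum_atMost_Suc_ends: "(\<Sum>i\<le>Suc k. F i) = F 0 + (\<Sum>i<k. F (Suc i)) + F (Suc k)"
  for F :: "nat \<Rightarrow> 'a :: comm_monoid_add"
  by (simp add: sum.atMost_shift add.assoc)

text \<open>In the sums for \<open>j \<le> k\<close> all initial pieces agree, so the entries of the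
  reversals are forced to agree one after the other. In the sum for \<open>j = k + 1\<close> only
  the two extreme terms can differ, which gives the final equation.\<close>

lemma outer_sums_first_difference:
  fixes G :: "nat \<Rightarrow> real"
  assumes inv: "same_outer_sums \<alpha> \<beta>"
    and k: "k < length \<alpha>" "take k \<alpha> = take k \<beta>" "\<alpha> ! k \<noteq> \<beta> ! k"
  shows "take k (rev \<alpha>) = take k (rev \<beta>)" (is ?suffix)
    and "Suc (2 * k) < length \<alpha>" (is ?len)
    and "(\<Prod>a\<leftarrow>take k \<alpha>. G a) * (partial_sum G (\<alpha> ! k) - partial_sum G (\<beta> ! k))
       = (\<Prod>a\<leftarrow>take k (rev \<alpha>). G a) * (partial_sum G (rev \<beta> ! k) - partial_sum G (rev \<alpha> ! k))"
      (is ?eq)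
proof -
  have len: "length \<beta> = length \<alpha>"
    using inv by (metis same_outer_sums_def size_mset)
  have sums: "(\<Sum>i\<le>j. outer_sum G \<alpha> i * outer_sum G (rev \<alpha>) (j - i))
      = (\<Sum>i\<le>j. outer_sum G \<beta> i * outer_sum G (rev \<beta>) (j - i))" if "j < length \<alpha>"
    for G :: "nat \<Rightarrow> real" and j
    using inv that by (simp add: same_outer_sums_def)
  have prefix: "outer_sum G \<alpha> i = outer_sum G \<beta> i" if "i \<le> k" for i and G :: "nat \<Rightarrow> real"
    using that k len by (intro outer_sum_cong) (auto dest: arg_cong[of _ _ "take i"] simp: min_def)
  \<comment> \<open>Equal multisets cannot differ in the last entry alone.\<close>
  have "Suc k \<noteq> length \<alpha>"
  proof
    assume "Suc k = length \<alpha>"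
    then have "\<alpha> = take k \<alpha> @ [\<alpha> ! k]" "\<beta> = take k \<beta> @ [\<beta> ! k]"
      using len by (metis lessI take_Suc_conv_app_nth take_all_iff le_refl)+
    then have "add_mset (\<alpha> ! k) (mset (take k \<alpha>)) = add_mset (\<beta> ! k) (mset (take k \<beta>))"
      using inv unfolding same_outer_sums_def
      by (metis mset_append mset_single_iff_right union_mset_add_mset_right add.right_neutral mset.simps)
    then show False
      using k by simp
  qed
  then have Suc_k: "Suc k < length \<alpha>"
    using k by simp
  have suffix: "take m (rev \<alpha>) = take m (rev \<beta>)" if "m \<le> k" for m
    using that
  proof (induction m)
    case (Suc m)
    have suf: "outer_sum G (rev \<alpha>) i = outer_sum G (rev \<beta>) i" if "i \<le> m" for i and G :: "nat \<Rightarrow> real"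
      using that Suc k len by (intro outer_sum_cong) (auto dest: arg_cong[of _ _ "take i"] simp: min_def)
    \<comment> \<open>In the sum for \<open>Suc m\<close> every term but the one for
      \<open>i = 0\<close> involves known pieces only; with all weights 1 that term is the entry
      \<open>rev \<alpha> ! m\<close>.\<close>
    have "(\<Sum>i<m. outer_sum G \<alpha> (Suc i) * outer_sum G (rev \<alpha>) (Suc m - Suc i))
        = (\<Sum>i<m. outer_sum G \<beta> (Suc i) * outer_sum G (rev \<beta>) (Suc m - Suc i))" for G :: "nat \<Rightarrow> real"
      using Suc.prems by (intro sum.cong refl) (auto simp: prefix suf)
    moreover have "outer_sum G \<alpha> (Suc m) * outer_sum G (rev \<alpha>) (Suc m - Suc m)
        = outer_sum G \<beta> (Suc m) * outer_sum G (rev \<beta>) (Suc m - Suc m)" for G :: "nat \<Rightarrow> real"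
      using Suc.prems by (simp add: prefix suf)
    ultimately have "outer_sum (\<lambda>_. 1 :: real) \<alpha> 0 * outer_sum (\<lambda>_. 1) (rev \<alpha>) (Suc m)
        = outer_sum (\<lambda>_. 1) \<beta> 0 * outer_sum (\<lambda>_. 1) (rev \<beta>) (Suc m)"
      using sums[of "Suc m" "\<lambda>_. 1"] Suc.prems k unfolding sum_atMost_Suc_ends by simp
    then have "rev \<alpha> ! m = rev \<beta> ! m"
      by (simp add: outer_sum_def partial_sum_one map_replicate_const)
    then show ?case
      using Suc k len by (simp add: take_Suc_conv_app_nth)
  qed simp
  then show ?suffix
    by simp
  have suf: "outer_sum G (rev \<alpha>) i = outer_sum G (rev \<beta>) i" if "i \<le> k" for i and G :: "nat \<Rightarrow> real"
    using that suffix k len by (intro outer_sum_cong) auto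
  have eq: "outer_sum G (rev \<alpha>) (Suc k) + outer_sum G \<alpha> (Suc k)
      = outer_sum G (rev \<beta>) (Suc k) + outer_sum G \<beta> (Suc k)" for G :: "nat \<Rightarrow> real"
  proof -
    have "(\<Sum>i<k. outer_sum G \<alpha> (Suc i) * outer_sum G (rev \<alpha>) (Suc k - Suc i))
        = (\<Sum>i<k. outer_sum G \<beta> (Suc i) * outer_sum G (rev \<beta>) (Suc k - Suc i))"
      by (intro sum.cong refl) (auto simp: prefix suf)
    then show ?thesis
      using sums[OF Suc_k, of G] unfolding sum_atMost_Suc_ends by (simp add: outer_sum_def[of _ _ 0])
  qed
  show ?eq
    using eq[of G] \<open>?suffix\<close> k by (simp add: outer_sum_def algebra_simps)
  \<comment> \<open>Otherwise the mirror image of position \<open>k\<close> is \<open>k\<close>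
    itself or lies in the common prefix, and the equation with all weights 1 forces
    \<open>\<alpha> ! k = \<beta> ! k\<close>.\<close>
  show ?len
  proof (rule ccontr)
    assume "\<not> ?len"
    then have "length \<alpha> - Suc k \<le> k"
      by simp
    have "real (rev \<alpha> ! k) + real (\<alpha> ! k) = real (rev \<beta> ! k) + real (\<beta> ! k)"
      using eq[of "\<lambda>_. 1"] by (simp add: outer_sum_def partial_sum_one map_replicate_const)
    then have "\<alpha> ! (length \<alpha> - Suc k) + \<alpha> ! k = \<beta> ! (length \<alpha> - Suc k) + \<beta> ! k"
      using k len by (simp add: rev_nth flip: of_nat_add)
    moreover have "\<alpha> ! (length \<alpha> - Suc k) = \<beta> ! (length \<alpha> - Suc k)" if "length \<alpha> - Suc k < k"
      using k(2) that by (metis nth_take)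
    ultimately show False
      using \<open>length \<alpha> - Suc k \<le> k\<close> k(3) by (cases "length \<alpha> - Suc k = k") auto
  qed
qed

section \<open>Unimodal and short compositions\<close>

lemma unimodal_iff:
  "unimodal \<alpha> \<longleftrightarrow> (\<exists>t<length \<alpha>. (\<forall>i j. i \<le> j \<and> j \<le> t \<longrightarrow> \<alpha> ! i \<le> \<alpha> ! j) \<and>
     (\<forall>i j. t \<le> i \<and> i \<le> j \<and> j < length \<alpha> \<longrightarrow> \<alpha> ! j \<le> \<alpha> ! i))"
proof -
  have "(\<forall>i. i < t \<longrightarrow> \<alpha> ! i \<le> \<alpha> ! Suc i) \<longleftrightarrow> (\<forall>i j. i \<le> j \<and> j \<le> t \<longrightarrow> \<alpha> ! i \<le> \<alpha> ! j)" for t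
  proof (intro iffI allI impI)
    fix i j assume *: "\<forall>i. i < t \<longrightarrow> \<alpha> ! i \<le> \<alpha> ! Suc i" "i \<le> j \<and> j \<le> t"
    then have "i \<le> j" "j \<le> t" by auto
    then show "\<alpha> ! i \<le> \<alpha> ! j"
    proof (induction j rule: dec_induct)
      case (step n)
      then show ?case using *(1) by (metis Suc_le_eq Suc_leD order_trans)
    qed simp
  qed auto
  moreover have "(\<forall>i. t \<le> i \<and> Suc i < length \<alpha> \<longrightarrow> \<alpha> ! i \<ge> \<alpha> ! Suc i)
      \<longleftrightarrow> (\<forall>i j. t \<le> i \<and> i \<le> j \<and> j < length \<alpha> \<longrightarrow> \<alpha> ! j \<le> \<alpha> ! i)" for t
  proof (intro iffI allI impI)
    fix i j assume *: "\<forall>i. t \<le> i \<and> Suc i < length \<alpha> \<longrightarrow> \<alpha> ! i \<ge> \<alpha> ! Suc i"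
      "t \<le> i \<and> i \<le> j \<and> j < length \<alpha>"
    then have "i \<le> j" "j < length \<alpha>" by auto
    then show "\<alpha> ! j \<le> \<alpha> ! i"
    proof (induction j rule: dec_induct)
      case (step n)
      then show ?case using * by (metis Suc_lessD order_trans)
    qed simp
  qed auto
  ultimately show ?thesis
    unfolding unimodal_def by simp
qed

lemma unimodal_rev:
  assumes "unimodal \<alpha>"
  shows "unimodal (rev \<alpha>)"
proof -
  obtain t where t: "t < length \<alpha>" "\<And>i j. i \<le> j \<Longrightarrow> j \<le> t \<Longrightarrow> \<alpha> ! i \<le> \<alpha> ! j"
    "\<And>i j. t \<le> i \<Longrightarrow> i \<le> j \<Longrightarrow> j < length \<alpha> \<Longrightarrow> \<alpha> ! j \<le> \<alpha> ! i"
    using assms unfolding unimodal_iff by blast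
  show ?thesis
    unfolding unimodal_iff
  proof (intro exI[of _ "length \<alpha> - Suc t"] conjI allI impI)
    fix i j assume "i \<le> j \<and> j \<le> length \<alpha> - Suc t"
    then have "i \<le> j" "j < length \<alpha>" "t \<le> length \<alpha> - Suc j"
      using t(1) by auto
    then show "rev \<alpha> ! i \<le> rev \<alpha> ! j"
      using t(3)[of "length \<alpha> - Suc j" "length \<alpha> - Suc i"] by (simp add: rev_nth)
  next
    fix i j assume "length \<alpha> - Suc t \<le> i \<and> i \<le> j \<and> j < length (rev \<alpha>)"
    then have "i \<le> j" "j < length \<alpha>" "length \<alpha> - Suc i \<le> t"
      by auto
    then show "rev \<alpha> ! j \<le> rev \<alpha> ! i"
      using t(2)[of "length \<alpha> - Suc j" "length \<alpha> - Suc i"] by (simp add: rev_nth)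
  qed (use t in auto)
qed

lemma unimodal_min_le:
  assumes "unimodal \<alpha>" "i \<le> j" "j \<le> m" "m < length \<alpha>"
  shows "min (\<alpha> ! i) (\<alpha> ! m) \<le> \<alpha> ! j"
proof -
  obtain t where t: "\<And>i j. i \<le> j \<Longrightarrow> j \<le> t \<Longrightarrow> \<alpha> ! i \<le> \<alpha> ! j"
    "\<And>i j. t \<le> i \<Longrightarrow> i \<le> j \<Longrightarrow> j < length \<alpha> \<Longrightarrow> \<alpha> ! j \<le> \<alpha> ! i"
    using assms(1) unfolding unimodal_iff by blast
  show ?thesis
    using t(1)[of i j] t(2)[of j m] assms by (cases "j \<le> t") auto
qed

text \<open>A rise from \<open>k\<close> to \<open>m\<close> puts the peak after
  \<open>k\<close>.\<close>

lemma unimodal_sorted_take: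
  assumes "unimodal \<alpha>" "k < m" "m < length \<alpha>" "\<alpha> ! k < \<alpha> ! m"
  shows "sorted (take k \<alpha>)"
proof -
  obtain t where t: "\<And>i j. i \<le> j \<Longrightarrow> j \<le> t \<Longrightarrow> \<alpha> ! i \<le> \<alpha> ! j"
    "\<And>i j. t \<le> i \<Longrightarrow> i \<le> j \<Longrightarrow> j < length \<alpha> \<Longrightarrow> \<alpha> ! j \<le> \<alpha> ! i"
    using assms(1) unfolding unimodal_iff by blast
  have "k < t"
    using t(2)[of k m] assms by fastforce
  then show ?thesis
    using t(1) by (auto simp: sorted_iff_nth_mono)
qed

text \<open>Prefix and suffix do not overlap, so they can be cancelled from the equal
  multisets.\<close>

lemma middle_eq:
  assumes "mset \<alpha> = mset \<beta>" "take k \<alpha> = take k \<beta>" "take k (rev \<alpha>) = take k (rev \<beta>)"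
    and "2 * k \<le> length \<alpha>"
  shows "(!) \<alpha> ` {k..<length \<alpha> - k} = (!) \<beta> ` {k..<length \<alpha> - k}"
proof -
  let ?n = "length \<alpha>"
  have len: "length \<beta> = ?n"
    using assms(1) by (metis size_mset)
  have split: "mset \<gamma>
      = mset (take k \<gamma>) + mset (take (?n - 2 * k) (drop k \<gamma>)) + mset (take k (rev \<gamma>))"
    and set: "set (take (?n - 2 * k) (drop k \<gamma>)) = (!) \<gamma> ` {k..<?n - k}"
    if "length \<gamma> = ?n" for \<gamma> :: "'a list"
  proof -
    have "\<gamma> = take k \<gamma> @ take (?n - 2 * k) (drop k \<gamma>) @ drop (?n - k) \<gamma>"
    proof -
      have "drop (?n - k) \<gamma> = drop (?n - 2 * k) (drop k \<gamma>)"
        using assms(4) by simp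
      then show ?thesis
        by (simp only: append_take_drop_id)
    qed
    then have "mset \<gamma> = mset (take k \<gamma> @ take (?n - 2 * k) (drop k \<gamma>) @ drop (?n - k) \<gamma>)"
      by simp
    then show "mset \<gamma>
        = mset (take k \<gamma>) + mset (take (?n - 2 * k) (drop k \<gamma>)) + mset (take k (rev \<gamma>))"
      using that by (simp add: take_rev)
    have "take (?n - 2 * k) (drop k \<gamma>) = map ((!) \<gamma>) [k..<?n - k]"
      using that assms(4) by (intro nth_equalityI) auto
    then show "set (take (?n - 2 * k) (drop k \<gamma>)) = (!) \<gamma> ` {k..<?n - k}"
      by simp
  qed
  have "mset (take (?n - 2 * k) (drop k \<alpha>)) = mset (take (?n - 2 * k) (drop k \<beta>))"
    using split[of \<alpha>] split[of \<beta>] assms len by simp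
  then have "set (take (?n - 2 * k) (drop k \<alpha>)) = set (take (?n - 2 * k) (drop k \<beta>))"
    by (rule mset_eq_setD)
  then show ?thesis
    using set len by simp
qed

text \<open>With all weights 1, the entries at \<open>k\<close> and at its mirror image
  \<open>?m\<close> have equal sums in \<open>\<alpha>\<close> and \<open>\<beta>\<close>. One more
  symmetric quantity determines the unordered pair, and
  \<open>\<alpha> ! k \<noteq> \<beta> ! k\<close> then leaves only the swap.\<close>

lemma ends_swapped:
  assumes inv: "same_outer_sums \<alpha> \<beta>" and pos: "\<forall>a\<in>set \<alpha>. 0 < a"
    and k: "k < length \<alpha>" "take k \<alpha> = take k \<beta>" "\<alpha> ! k \<noteq> \<beta> ! k"
    and "length \<alpha> \<le> 4 \<or> unimodal \<alpha> \<and> unimodal \<beta>"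
  shows "rev \<beta> ! k = \<alpha> ! k" "\<beta> ! k = rev \<alpha> ! k"
proof -
  let ?m = "length \<alpha> - Suc k"
  note first = outer_sums_first_difference[OF inv k]
  have msets: "mset \<alpha> = mset \<beta>"
    using inv by (simp add: same_outer_sums_def)
  then have len: "length \<beta> = length \<alpha>"
    by (metis size_mset)
  then have rev: "rev \<alpha> ! k = \<alpha> ! ?m" "rev \<beta> ! k = \<beta> ! ?m"
    using k by (simp_all add: rev_nth)
  have m: "k < ?m" "?m < length \<alpha>"
    using first(2) by auto
  have set_eq: "set \<alpha> = set \<beta>"
    using msets by (rule mset_eq_setD)
  have "\<forall>a\<in>set \<beta>. 0 < a"
    using pos set_eq by blast
  then have positive: "0 < \<alpha> ! k" "0 < \<alpha> ! ?m" "0 < \<beta> ! k" "0 < \<beta> ! ?m"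
    using pos m k(1) len by (simp_all only: nth_mem Ball_def)
  have middle: "(!) \<alpha> ` {k..?m} = (!) \<beta> ` {k..?m}"
  proof -
    have "{k..?m} = {k..<length \<alpha> - k}"
      using m by auto
    then show ?thesis
      using middle_eq[OF msets k(2) first(1)] first(2) by simp
  qed
  have diff: "(\<Prod>a\<leftarrow>take k \<alpha>. G a) * (partial_sum G (\<alpha> ! k) - partial_sum G (\<beta> ! k))
       = (\<Prod>a\<leftarrow>take k (rev \<alpha>). G a) * (partial_sum G (\<beta> ! ?m) - partial_sum G (\<alpha> ! ?m))"
    for G :: "nat \<Rightarrow> real"
    using first(3)[of G] by (simp only: rev)
  have total: "\<alpha> ! k + \<alpha> ! ?m = \<beta> ! k + \<beta> ! ?m"
    using diff[of "\<lambda>_. 1"] by (simp add: partial_sum_one map_replicate_const)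
  from assms(6) have "\<beta> ! ?m = \<alpha> ! k \<and> \<beta> ! k = \<alpha> ! ?m"
  proof
    \<comment> \<open>A unimodal sequence attains the minimum of its middle part at an end of it,
      and the middle parts have the same entries.\<close>
    assume "unimodal \<alpha> \<and> unimodal \<beta>"
    then have low: "min (\<gamma> ! k) (\<gamma> ! ?m) \<le> \<gamma> ! j" if "j \<in> {k..?m}" "\<gamma> = \<alpha> \<or> \<gamma> = \<beta>" for j \<gamma>
      using that m len unimodal_min_le[of \<gamma> k j ?m] by auto
    have least: "min (\<gamma> ! k) (\<gamma> ! ?m) \<in> (!) \<gamma> ` {k..?m}" for \<gamma> :: "nat list"
      using m by (cases "\<gamma> ! k \<le> \<gamma> ! ?m") (simp_all add: min_def)
    have "min (\<beta> ! k) (\<beta> ! ?m) \<le> min (\<alpha> ! k) (\<alpha> ! ?m)"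
      using least[of \<alpha>] low[of _ \<beta>] unfolding middle by (elim imageE) simp
    moreover have "min (\<alpha> ! k) (\<alpha> ! ?m) \<le> min (\<beta> ! k) (\<beta> ! ?m)"
      using least[of \<beta>] low[of _ \<alpha>] unfolding middle[symmetric] by (elim imageE) simp
    ultimately have "min (\<alpha> ! k) (\<alpha> ! ?m) = min (\<beta> ! k) (\<beta> ! ?m)"
      by (rule order_antisym[rotated])
    then show ?thesis
      using total k(3) by (simp add: min_def split: if_splits)
  next
    assume "length \<alpha> \<le> 4"
    then have "k = 0 \<or> k = 1 \<and> ?m = 2"
      using first(2) by auto
    then show ?thesis
    proof
      assume "k = 0"
      \<comment> \<open>For \<open>k = 0\<close> the products are empty, and the indicator weight of
        \<open>c\<close> counts the end entries that are at least \<open>c\<close>; this determines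
        the larger one.\<close>
      have max: "c \<le> max (\<alpha> ! k) (\<alpha> ! ?m) \<longleftrightarrow> c \<le> max (\<beta> ! k) (\<beta> ! ?m)" if "0 < c" for c
      proof -
        have "(if c \<le> \<alpha> ! k then 1 else 0) + (if c \<le> \<alpha> ! ?m then 1 else 0)
            = (if c \<le> \<beta> ! k then 1 else 0) + (if c \<le> \<beta> ! ?m then 1 else 0 :: real)"
          using diff[of "\<lambda>r. if r = c then 1 else 0"] \<open>k = 0\<close>
          unfolding partial_sum_indicator[OF that] by simp
        then show ?thesis
          unfolding le_max_iff_disj by (auto split: if_splits)
      qed
      have "0 < max (\<alpha> ! k) (\<alpha> ! ?m)" "0 < max (\<beta> ! k) (\<beta> ! ?m)"
        using positive by (simp_all add: less_max_iff_disj)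
      from iffD1[OF max[OF this(1)] order_refl] iffD2[OF max[OF this(2)] order_refl]
      have "max (\<alpha> ! k) (\<alpha> ! ?m) = max (\<beta> ! k) (\<beta> ! ?m)"
        by (rule order_antisym)
      then show ?thesis
        using total k(3) by (simp add: max_def split: if_splits)
    next
      \<comment> \<open>The middle part consists of just these two entries.\<close>
      assume "k = 1 \<and> ?m = 2"
      then have "{k..?m} = {k, ?m}"
        by auto
      then show ?thesis
        using middle total k(3) by auto
    qed
  qed
  then show "rev \<beta> ! k = \<alpha> ! k" "\<beta> ! k = rev \<alpha> ! k"
    by (simp_all add: rev)
qed

text \<open>After the swap, both sides of the equation of the first difference carry the same
  non-zero difference of partial sums. Cancelling it shows that prefix and suffix have the same
  multiset; their order is forced by length at most 1 or by sortedness.\<close>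

lemma outer_parts_symmetric:
  assumes inv: "same_outer_sums \<alpha> \<beta>" and pos: "\<forall>a\<in>set \<alpha>. 0 < a"
    and k: "k < length \<alpha>" "take k \<alpha> = take k \<beta>" "\<alpha> ! k \<noteq> \<beta> ! k"
    and cond: "length \<alpha> \<le> 4 \<or> unimodal \<alpha> \<and> unimodal \<beta>"
  shows "take k (rev \<beta>) = take k \<alpha>"
proof -
  let ?m = "length \<alpha> - Suc k"
  note first = outer_sums_first_difference[OF inv k] and swap = ends_swapped[OF inv pos k cond]
  have "mset \<alpha> = mset \<beta>"
    using inv by (simp add: same_outer_sums_def)
  then have len: "length \<beta> = length \<alpha>"
    by (metis size_mset)
  have ne: "\<alpha> ! k \<noteq> rev \<alpha> ! k"
    using swap k(3) by simp
  have "(\<Prod>a\<leftarrow>take k \<alpha>. G a) = (\<Prod>a\<leftarrow>take k (rev \<alpha>). G a)" if "\<And>a. 0 < G a"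
    for G :: "nat \<Rightarrow> real"
  proof -
    have "partial_sum G (\<alpha> ! k) \<noteq> partial_sum G (rev \<alpha> ! k)"
      using ne partial_sum_strict_mono[of G "\<alpha> ! k" "rev \<alpha> ! k", OF that]
        partial_sum_strict_mono[of G "rev \<alpha> ! k" "\<alpha> ! k", OF that]
      by (cases "\<alpha> ! k < rev \<alpha> ! k") auto
    then show ?thesis
      using first(3)[of G] by (simp add: swap)
  qed
  then have msets: "mset (take k \<alpha>) = mset (take k (rev \<alpha>))"
    by (rule mset_eqI_prod_list)
  have "take k \<alpha> = take k (rev \<alpha>)"
    using cond
  proof
    assume "length \<alpha> \<le> 4"
    then have "length (take k \<alpha>) \<le> 1"
      using first(2) by simp
    then obtain a where "take k \<alpha> = [] \<or> take k \<alpha> = [a]"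
      by (cases "take k \<alpha>") auto
    then show ?thesis
      using msets by (auto simp: mset_single_iff_right)
  next
    assume uni: "unimodal \<alpha> \<and> unimodal \<beta>"
    then have uni_rev: "unimodal (rev \<alpha>)" "unimodal (rev \<beta>)"
      by (simp_all add: unimodal_rev)
    have m: "k < ?m" "?m < length \<alpha>"
      using first(2) by auto
    have at_m: "\<alpha> ! ?m = rev \<alpha> ! k" "\<beta> ! ?m = rev \<beta> ! k" "rev \<alpha> ! ?m = \<alpha> ! k" "rev \<beta> ! ?m = \<beta> ! k"
      using k len by (simp_all add: rev_nth Suc_diff_Suc)
    \<comment> \<open>By the swap, \<open>\<alpha>\<close> and \<open>rev \<beta>\<close> both rise
      from \<open>k\<close> to \<open>?m\<close>, or else \<open>\<beta>\<close> and
      \<open>rev \<alpha>\<close> do; in either case one of the two begins with the common prefix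
      and the other with the reversed common suffix.\<close>
    have "sorted (take k \<alpha>) \<and> sorted (take k (rev \<alpha>))"
    proof (cases "\<alpha> ! k < rev \<alpha> ! k")
      case True
      then show ?thesis
        using unimodal_sorted_take[of \<alpha> k ?m] unimodal_sorted_take[of "rev \<beta>" k ?m]
          uni uni_rev m len first(1)
        by (simp add: at_m swap)
    next
      case False
      then have "rev \<alpha> ! k < \<alpha> ! k"
        using ne by simp
      then show ?thesis
        using unimodal_sorted_take[of \<beta> k ?m] unimodal_sorted_take[of "rev \<alpha>" k ?m]
          uni uni_rev m len k(2)
        by (simp add: at_m swap)
    qed
    then show ?thesis
      using msets by (metis properties_for_sort sorted_sort_id)
  qed
  then show ?thesis
    using first(1) by simp
qed

text \<open>Extends the common prefix by induction: when the candidate \<open>\<gamma>\<close> first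
  differs from \<open>\<alpha>\<close> at \<open>k\<close>, its reversal agrees with
  \<open>\<alpha>\<close> up to and including \<open>k\<close>.\<close>

lemma eq_or_eq_rev:
  assumes inv: "same_outer_sums \<alpha> \<beta>" and pos: "\<forall>a\<in>set \<alpha>. 0 < a"
    and cond: "length \<alpha> \<le> 4 \<or> unimodal \<alpha> \<and> unimodal \<beta>"
  shows "\<beta> = \<alpha> \<or> \<beta> = rev \<alpha>"
proof -
  have len: "length \<beta> = length \<alpha>"
    using inv by (metis same_outer_sums_def size_mset)
  have "\<exists>\<gamma>\<in>{\<beta>, rev \<beta>}. take k \<alpha> = take k \<gamma>" if "k \<le> length \<alpha>" for k
    using that
  proof (induction k)
    case (Suc k)
    then obtain \<gamma> where \<gamma>: "\<gamma> \<in> {\<beta>, rev \<beta>}" "take k \<alpha> = take k \<gamma>"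
      by auto
    then have len_\<gamma>: "length \<gamma> = length \<alpha>"
      using len by auto
    have inv_\<gamma>: "same_outer_sums \<alpha> \<gamma>"
      using \<gamma>(1) inv same_outer_sums_rev by auto
    have cond_\<gamma>: "length \<alpha> \<le> 4 \<or> unimodal \<alpha> \<and> unimodal \<gamma>"
      using \<gamma>(1) cond unimodal_rev by auto
    show ?case
    proof (cases "\<alpha> ! k = \<gamma> ! k")
      case True
      then have "take (Suc k) \<alpha> = take (Suc k) \<gamma>"
        using \<gamma>(2) Suc.prems len_\<gamma> by (simp add: take_Suc_conv_app_nth)
      then show ?thesis
        using \<gamma>(1) by blast
    next
      case False
      have "k < length \<alpha>"
        using Suc.prems by simp
      note args = inv_\<gamma> pos this \<gamma>(2) False cond_\<gamma>
      have "take (Suc k) \<alpha> = take (Suc k) (rev \<gamma>)"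
        using outer_parts_symmetric[OF args] ends_swapped(1)[OF args] Suc.prems len_\<gamma>
        by (simp add: take_Suc_conv_app_nth)
      then show ?thesis
        using \<gamma>(1) by auto
    qed
  qed auto
  from this[of "length \<alpha>"] show ?thesis
    using len by (auto simp: rev_swap)
qed

section \<open>Reversal of signed paths and the conclusion\<close>

lemma isomorphic_refl: "isomorphic G G"
  unfolding isomorphic_def by (intro exI[of _ id]) auto

lemma isomorphic_signed_path_rev:
  assumes "composition \<alpha>"
  shows "isomorphic (signed_path \<alpha>) (signed_path (rev \<alpha>))"
proof -
  \<comment> \<open>This traverses the path backwards. It is defined for every composition so that
    the map for \<open>rev \<alpha>\<close> serves as the inverse, and inclusions of edge sets in
    both directions follow from one argument.\<close>
  define f where "f \<alpha> = (\<lambda>(i, j). (length \<alpha> - Suc i, \<alpha> ! i - Suc j))" for \<alpha> :: "nat list"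
  have verts: "f \<gamma> v \<in> verts (signed_path (rev \<gamma>)) \<and> f (rev \<gamma>) (f \<gamma> v) = v"
    if "v \<in> verts (signed_path \<gamma>)" for \<gamma> v
    using that by (auto simp: signed_path_def f_def rev_nth Suc_diff_Suc)
  have pos: "(\<lambda>e. f \<gamma> ` e) ` pos_edges (signed_path \<gamma>) \<subseteq> pos_edges (signed_path (rev \<gamma>))" for \<gamma>
  proof clarify
    fix e assume "e \<in> pos_edges (signed_path \<gamma>)"
    then obtain i j where ij: "e = {(i, j), (i, Suc j)}" "i < length \<gamma>" "Suc j < \<gamma> ! i"
      by (auto simp: signed_path_def)
    let ?i = "length \<gamma> - Suc i" and ?j = "\<gamma> ! i - Suc (Suc j)"
    have "f \<gamma> ` e = {(?i, ?j), (?i, Suc ?j)}" "?i < length (rev \<gamma>)" "Suc ?j < rev \<gamma> ! ?i"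
      using ij by (auto simp: f_def rev_nth Suc_diff_Suc)
    then show "f \<gamma> ` e \<in> pos_edges (signed_path (rev \<gamma>))"
      unfolding signed_path_def by auto
  qed
  have neg: "(\<lambda>e. f \<gamma> ` e) ` neg_edges (signed_path \<gamma>) \<subseteq> neg_edges (signed_path (rev \<gamma>))"
    if "composition \<gamma>" for \<gamma>
  proof clarify
    fix e assume "e \<in> neg_edges (signed_path \<gamma>)"
    then obtain i where i: "e = {(i, \<gamma> ! i - 1), (Suc i, 0)}" "Suc i < length \<gamma>"
      by (auto simp: signed_path_def)
    have "0 < \<gamma> ! i"
      using that i by (auto simp: composition_def)
    let ?i = "length \<gamma> - Suc (Suc i)"
    have "f \<gamma> ` e = {(?i, rev \<gamma> ! ?i - 1), (Suc ?i, 0)}" "Suc ?i < length (rev \<gamma>)"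
      using i \<open>0 < \<gamma> ! i\<close> by (auto simp: f_def rev_nth Suc_diff_Suc)
    then show "f \<gamma> ` e \<in> neg_edges (signed_path (rev \<gamma>))"
      unfolding signed_path_def by auto
  qed
  have comp: "composition (rev \<alpha>)"
    using assms by (simp add: composition_def)
  have inv: "f \<alpha> ` f (rev \<alpha>) ` e = e" if "e \<subseteq> verts (signed_path (rev \<alpha>))" for e
    using that verts[of _ "rev \<alpha>"] by (force simp: image_image)
  have wf: "wf_signed_graph (signed_path (rev \<alpha>))"
    using comp by (rule wf_signed_path)
  have "pos_edges (signed_path (rev \<alpha>)) \<subseteq> (\<lambda>e. f \<alpha> ` e) ` pos_edges (signed_path \<alpha>)"
  proof
    fix e assume e: "e \<in> pos_edges (signed_path (rev \<alpha>))"
    then have "f \<alpha> ` f (rev \<alpha>) ` e = e"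
      using wf inv by (auto simp: wf_signed_graph_def)
    moreover have "f (rev \<alpha>) ` e \<in> pos_edges (signed_path \<alpha>)"
      using pos[of "rev \<alpha>"] e by auto
    ultimately show "e \<in> (\<lambda>e. f \<alpha> ` e) ` pos_edges (signed_path \<alpha>)"
      by (metis imageI)
  qed
  moreover have "neg_edges (signed_path (rev \<alpha>)) \<subseteq> (\<lambda>e. f \<alpha> ` e) ` neg_edges (signed_path \<alpha>)"
  proof
    fix e assume e: "e \<in> neg_edges (signed_path (rev \<alpha>))"
    then have "f \<alpha> ` f (rev \<alpha>) ` e = e"
      using wf inv by (auto simp: wf_signed_graph_def)
    moreover have "f (rev \<alpha>) ` e \<in> neg_edges (signed_path \<alpha>)"
      using neg[OF comp] e by auto
    ultimately show "e \<in> (\<lambda>e. f \<alpha> ` e) ` neg_edges (signed_path \<alpha>)"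
      by (metis imageI)
  qed
  moreover have "bij_betw (f \<alpha>) (verts (signed_path \<alpha>)) (verts (signed_path (rev \<alpha>)))"
    using verts[of _ \<alpha>] verts[of _ "rev \<alpha>"]
    by (intro bij_betw_byWitness[of _ "f (rev \<alpha>)"]) auto
  moreover have "f \<alpha> ` loops (signed_path \<alpha>) = loops (signed_path (rev \<alpha>))"
    by (simp add: signed_path_def)
  ultimately show ?thesis
    unfolding isomorphic_def using pos[of \<alpha>] neg[OF assms] by (intro exI[of _ "f \<alpha>"]) auto
qed

theorem theorem1p9:
  fixes \<alpha> \<beta> :: "nat list"
  assumes "composition \<alpha>" and "composition \<beta>"
    and "chromatic (signed_path \<alpha>) = chromatic (signed_path \<beta>)"
    and "length \<alpha> \<le> 4 \<or> (unimodal \<alpha> \<and> unimodal \<beta>)"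
  shows "isomorphic (signed_path \<alpha>) (signed_path \<beta>)"
proof -
  have msets: "mset \<alpha> = mset \<beta>"
  proof (rule mset_eqI_prod_list)
    fix G :: "nat \<Rightarrow> real"
    have "complex_of_real (\<Prod>a\<leftarrow>l. G a) = (\<Prod>a\<leftarrow>l. complex_of_real (G a))" for l
      by (induction l) simp_all
    then show "(\<Prod>a\<leftarrow>\<alpha>. G a) = (\<Prod>a\<leftarrow>\<beta>. G a)"
      using chromatic_invariants(1)[OF assms(1-3), of "\<lambda>a. complex_of_real (G a)"]
      by (metis of_real_eq_iff)
  qed
  then have "length \<beta> = length \<alpha>"
    by (metis size_mset)
  then have "(\<Sum>i\<le>j. outer_sum G \<alpha> i * outer_sum G (rev \<alpha>) (j - i))
      = (\<Sum>i\<le>j. outer_sum G \<beta> i * outer_sum G (rev \<beta>) (j - i))"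
    if "j < length \<alpha>" for G :: "nat \<Rightarrow> real" and j
    using chromatic_invariants(2)[OF assms(1-3), of j "\<lambda>a. complex_of_real (G a)"] that
    unfolding outer_sum_of_real of_real_mult[symmetric] of_real_sum[symmetric] of_real_eq_iff by simp
  then have "same_outer_sums \<alpha> \<beta>"
    using msets by (simp add: same_outer_sums_def)
  moreover have "\<forall>a\<in>set \<alpha>. 0 < a"
    using assms(1) by (simp add: composition_def)
  ultimately have "\<beta> = \<alpha> \<or> \<beta> = rev \<alpha>"
    using assms(4) by (rule eq_or_eq_rev)
  then show ?thesis
    using assms(1) isomorphic_refl isomorphic_signed_path_rev by blast
qed

end
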